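(* Let $k\ge 3$, let $g$ be an even integer, and let $G$ be a minimal $(k,g)$-cage with diameter $d$. The distance spectral radius of the subdivision graph $S(G)$ is $$(3k-2)S_1'+dk(k-1)^{d-1}+\sqrt{(k-2)^2S_1'^{2}+2kS_2'^{2}+2d(k-2)^2(k-1)^{d-1}S_1'+d^2(k-2)^2(k-1)^{2d-2}},$$ where $$S_1'=\frac{1}{(2-k)^2}\big[(kd-2d-k+1)(k-1)^{d-1}+1\big],\qquad S_2'=\frac{1}{(2-k)^2}\big[(2kd-4d-k)(k-1)^{d}+k\big].$$
   Context: All graphs are finite, simple, connected and undirected. The distance matrix $D(H)$ of a graph $H$ has $(i,j)$ entry equal to the graph distance between the $i$-th and $j$-th vertices; the distance spectral radius of $H$ is the largest eigenvalue of $D(H)$. The subdivision graph $S(G)$ is obtained from $G$ by inserting a new vertex of degree $2$ on each edge of $G$. A $(k,g)$-cage is a $k$-regular simple graph of girth $g$ with the minimum possible number of vertices $n(k,g)$. With $d=\lfloor g/2\rfloor$, one has the lower bound $n(k,g)\ge n_0(k,g)$, where $n_0(k,g)=1+\sum_{i=0}^{d-1}k(k-1)^i$ if $g$ is odd, and $n_0(k,g)=1+\sum_{i=0}^{d-2}k(k-1)^i+(k-1)^{d-1}$ if $g$ is even. A minimal $(k,g)$-cage (Moore graph) is a $(k,g)$-cage with exactly $n_0(k,g)$ vertices; its diameter is $d=\lfloor g/2\rfloor$. *)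

theory Defs
  imports
    "Graph_Theory.Graph_Theory"
    "Jordan_Normal_Form.Spectral_Radius"
    "HOL-Library.Extended_Nat"
begin

text \<open>A finite simple undirected graph is a \<^locale>\<open>pair_graph\<close>: every edge \<open>{u, v}\<close> is
  represented by the two arcs \<open>(u, v)\<close> and \<open>(v, u)\<close>.\<close>

definition connected_graph :: "'a pair_pre_digraph \<Rightarrow> bool" where
  "connected_graph G \<longleftrightarrow> pair_graph G \<and> Digraph_Component.connected (with_proj G)"

definition graph_dist :: "'a pair_pre_digraph \<Rightarrow> 'a \<Rightarrow> 'a \<Rightarrow> nat" where
  "graph_dist G u v = (LEAST n. \<exists>p. pre_digraph.awalk (with_proj G) u p v \<and> length p = n)"

text \<open>This is the library's shortest-path distance for unit arc weights.\<close>

lemma graph_dist_eq_mu: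
  assumes "pair_wf_digraph G" "u \<rightarrow>\<^sup>*\<^bsub>with_proj G\<^esub> v"
  shows "wf_digraph.\<mu> (with_proj G) (\<lambda>_. 1) u v = ereal (real (graph_dist G u v))"
proof -
  interpret pair_wf_digraph G by fact
  let ?P = "\<lambda>n. \<exists>p. awalk u p v \<and> length p = n"
  have cost: "awalk_cost (\<lambda>_. 1) p = real (length p)" for p :: "('a \<times> 'a) list"
    by (induction p) auto
  from assms(2) obtain p where "awalk u p v" by (auto simp: reachable_awalk)
  then have "?P (length p)" by blast
  then have "?P (graph_dist G u v)"
    unfolding graph_dist_def by (rule LeastI)
  then obtain q where q: "awalk u q v" "length q = graph_dist G u v" by blast
  have "graph_dist G u v \<le> length r" if "awalk u r v" for r
    unfolding graph_dist_def using that by (intro Least_le) blast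
  then have "(INF r\<in>{r. awalk u r v}. ereal (real (length r))) = ereal (real (graph_dist G u v))"
    using q by (intro antisym INF_greatest) (auto intro!: INF_lower2[of q])
  then show ?thesis by (simp add: \<mu>_def cost)
qed

definition graph_diameter :: "'a pair_pre_digraph \<Rightarrow> nat" where
  "graph_diameter G = Max {graph_dist G u v | u v. u \<in> pverts G \<and> v \<in> pverts G}"

definition regular_graph :: "nat \<Rightarrow> 'a pair_pre_digraph \<Rightarrow> bool" where
  "regular_graph k G \<longleftrightarrow> (\<forall>v \<in> pverts G. out_degree (with_proj G) v = k)"

text \<open>The library's \<open>cycle\<close> also admits the closed walk \<open>u, v, u\<close> along a single undirected
  edge, hence the restriction to length at least 3. The girth of a forest is \<open>\<infinity>\<close>.\<close>

definition girth :: "'a pair_pre_digraph \<Rightarrow> enat" where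
  "girth G = (INF p \<in> {p. pre_digraph.cycle (with_proj G) p \<and> length p \<ge> 3}. enat (length p))"

definition regular_girth_graph :: "nat \<Rightarrow> nat \<Rightarrow> 'a pair_pre_digraph \<Rightarrow> bool" where
  "regular_girth_graph k g G \<longleftrightarrow> connected_graph G \<and> regular_graph k G \<and> girth G = enat g"

text \<open>The minimum \<open>n(k, g)\<close>. Every finite graph is isomorphic to one whose vertices are natural
  numbers, so restricting to these is no loss of generality.\<close>

definition cage_order :: "nat \<Rightarrow> nat \<Rightarrow> nat" where
  "cage_order k g =
    (LEAST n. \<exists>H :: nat pair_pre_digraph. regular_girth_graph k g H \<and> card (pverts H) = n)"

definition cage :: "nat \<Rightarrow> nat \<Rightarrow> 'a pair_pre_digraph \<Rightarrow> bool" where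
  "cage k g G \<longleftrightarrow> regular_girth_graph k g G \<and> card (pverts G) = cage_order k g"

definition moore_bound :: "nat \<Rightarrow> nat \<Rightarrow> nat" where
  "moore_bound k g =
    (let d = g div 2 in
     if odd g then 1 + (\<Sum>i<d. k * (k - 1) ^ i)
     else 1 + (\<Sum>i<d - 1. k * (k - 1) ^ i) + (k - 1) ^ (d - 1))"

definition minimal_cage :: "nat \<Rightarrow> nat \<Rightarrow> 'a pair_pre_digraph \<Rightarrow> bool" where
  "minimal_cage k g G \<longleftrightarrow> cage k g G \<and> card (pverts G) = moore_bound k g"

definition edge_set :: "'a pair_pre_digraph \<Rightarrow> 'a set set" where
  "edge_set G = {{u, v} | u v. (u, v) \<in> parcs G}"

text \<open>\<open>Inl v\<close> is the original vertex \<open>v\<close>, and \<open>Inr e\<close> is the new vertex inserted on the edge \<open>e\<close>.\<close>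

definition subdivision_graph :: "'a pair_pre_digraph \<Rightarrow> ('a + 'a set) pair_pre_digraph" where
  "subdivision_graph G =
    \<lparr> pverts = Inl ` pverts G \<union> Inr ` edge_set G,
      parcs = {(Inl v, Inr e) | v e. e \<in> edge_set G \<and> v \<in> e} \<union>
              {(Inr e, Inl v) | v e. e \<in> edge_set G \<and> v \<in> e} \<rparr>"

text \<open>The list \<open>vs\<close> enumerates the vertices of \<open>H\<close> without repetition.\<close>

definition distance_matrix :: "'a pair_pre_digraph \<Rightarrow> 'a list \<Rightarrow> real mat" where
  "distance_matrix H vs =
    mat (length vs) (length vs) (\<lambda>(i, j). real (graph_dist H (vs ! i) (vs ! j)))"

text \<open>The matrix is real symmetric, so its real eigenvalues are all of its eigenvalues.\<close>

definition distance_spectral_radius :: "'a pair_pre_digraph \<Rightarrow> 'a list \<Rightarrow> real" where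
  "distance_spectral_radius H vs = Max (spectrum (distance_matrix H vs))"

text \<open>For \<open>k > 2\<close> and \<open>d > 0\<close>, the closed forms of \<open>\<Sum>i=1..d-1. i * (k-1)^(i-1)\<close> and
  \<open>\<Sum>i=1..d. (2*i-1) * (k-1)^(i-1)\<close>.\<close>

definition S1' :: "nat \<Rightarrow> nat \<Rightarrow> real" where
  "S1' k d = 1 / (2 - real k)\<^sup>2 *
    ((real k * real d - 2 * real d - real k + 1) * (real k - 1) ^ (d - 1) + 1)"

definition S2' :: "nat \<Rightarrow> nat \<Rightarrow> real" where
  "S2' k d = 1 / (2 - real k)\<^sup>2 *
    ((2 * real k * real d - 4 * real d - real k) * (real k - 1) ^ d + real k)"

end

theory Submission
  imports Defs
begin

text \<open>
  Let \<open>q = k - 1\<close>. Girth \<open>2 d\<close> makes the neighbourhood of every vertex a tree up to depth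
  \<open>d - 1\<close>, and attaining the Moore bound forces the remaining \<open>q\<^sup>d\<^sup>-\<^sup>1\<close> vertices to lie at
  distance exactly \<open>d\<close> with all their neighbours at distance \<open>d - 1\<close>. So the numbers of vertices
  at each distance from a vertex, and likewise from an edge, do not depend on the vertex or edge.
  The partition of the vertices of the subdivision graph into old and new ones is therefore
  equitable for the distance matrix, with quotient
  \<open>[[2 k S1' + 2 d q\<^sup>d\<^sup>-\<^sup>1, k S2'], [2 S2', 4 q S1' + 2 d q\<^sup>d]]\<close>.
  The larger root of its characteristic polynomial has an eigenvector that is positive and constant
  on both classes, and an eigenvalue with a positive eigenvector of a nonnegative symmetric matrix
  is the largest one.
\<close>

section \<open>Distances and cycles through relation powers\<close>

text \<open>For a vertex \<open>u\<close> this agrees with \<open>graph_dist\<close>, but it needs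
  only the arc relation, so the same lemmas serve a graph and its subdivision.\<close>

definition rdist :: "('a \<times> 'a) set \<Rightarrow> 'a \<Rightarrow> 'a \<Rightarrow> nat" where
  "rdist E u v = (LEAST n. (u, v) \<in> E ^^ n)"

lemma rdist_le: "(u, v) \<in> E ^^ n \<Longrightarrow> rdist E u v \<le> n"
  unfolding rdist_def by (rule Least_le)

lemma relpow_rdist: "(u, v) \<in> E\<^sup>* \<Longrightarrow> (u, v) \<in> E ^^ rdist E u v"
  unfolding rdist_def using rtrancl_imp_relpow by (metis LeastI)

lemma relpow_converse:
  fixes E :: "('a \<times> 'a) set"
  shows "(u, v) \<in> (E\<inverse>) ^^ n \<longleftrightarrow> (v, u) \<in> E ^^ n"
proof (induction n arbitrary: u v)
  case (Suc n)
  have "(u, v) \<in> (E\<inverse>) ^^ Suc n \<longleftrightarrow> (\<exists>x. (x, u) \<in> E ^^ n \<and> (v, x) \<in> E)"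
    using Suc by auto
  also have "\<dots> \<longleftrightarrow> (v, u) \<in> E ^^ Suc n"
    by (metis relpow_Suc_D2 relpow_Suc_I2)
  finally show ?case .
qed auto

lemma relpow_sym: "sym E \<Longrightarrow> (u, v) \<in> E ^^ n \<longleftrightarrow> (v, u) \<in> E ^^ n"
  using relpow_converse[of u v n E] by (simp add: sym_conv_converse_eq)

lemma rdist_sym: "sym E \<Longrightarrow> rdist E u v = rdist E v u"
  unfolding rdist_def by (subst relpow_sym) auto

text \<open>A certificate for a guessed distance function \<open>f\<close>: growing by at most one
  along each arc makes \<open>f\<close> a lower bound, and descending through predecessors from
  \<open>w\<close> reaches \<open>u\<close> in \<open>f w\<close> steps. It verifies the distance
  formulas in the subdivision graph.\<close>

lemma rdist_eqI:
  assumes "w \<in> V" "f u = 0"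
    and Lip: "\<And>x y. (x, y) \<in> E \<Longrightarrow> f y \<le> Suc (f x)"
    and zero: "\<And>y. y \<in> V \<Longrightarrow> f y = 0 \<Longrightarrow> y = u"
    and pred: "\<And>y m. y \<in> V \<Longrightarrow> f y = Suc m \<Longrightarrow> \<exists>x\<in>V. (x, y) \<in> E \<and> f x = m"
  shows "rdist E u w = f w"
proof -
  have "y \<in> V \<Longrightarrow> f y = n \<Longrightarrow> (u, y) \<in> E ^^ n" for y n
  proof (induction n arbitrary: y)
    case 0
    then show ?case using zero by auto
  next
    case (Suc n)
    then show ?case using pred[OF Suc.prems] by auto
  qed
  moreover have "(u, y) \<in> E ^^ n \<Longrightarrow> f y \<le> n" for y n
  proof (induction n arbitrary: y)
    case 0
    then show ?case using assms(2) by simp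
  next
    case (Suc n)
    then obtain z where "(u, z) \<in> E ^^ n" "(z, y) \<in> E" by auto
    then show ?case using Suc.IH[of z] Lip[of z y] by simp
  qed
  ultimately show ?thesis
    unfolding rdist_def using \<open>w \<in> V\<close> by (intro Least_equality) auto
qed

text \<open>The premise on \<open>u\<close> matters for \<open>n = 0\<close>: the empty walk must
  sit at a vertex of the graph, whereas the zeroth relation power is the identity on the whole
  type.\<close>

lemma (in pair_wf_digraph) ex_awalk_iff_relpow:
  assumes "u \<in> pverts G"
  shows "(\<exists>p. awalk u p v \<and> length p = n) \<longleftrightarrow> (u, v) \<in> parcs G ^^ n"
  using assms
proof (induction n arbitrary: u)
  case 0
  then show ?case by (auto simp: awalk_Nil_iff)
next
  case (Suc n)
  have "(\<exists>p. awalk u p v \<and> length p = Suc n)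
      \<longleftrightarrow> (\<exists>w p. (u, w) \<in> parcs G \<and> awalk w p v \<and> length p = n)"
  proof
    assume "\<exists>p. awalk u p v \<and> length p = Suc n"
    then obtain e p where "awalk u (e # p) v" "length p = n"
      by (metis length_Suc_conv)
    then show "\<exists>w p. (u, w) \<in> parcs G \<and> awalk w p v \<and> length p = n"
      by (cases e) (auto simp: awalk_Cons_iff)
  next
    assume "\<exists>w p. (u, w) \<in> parcs G \<and> awalk w p v \<and> length p = n"
    then obtain w p where "awalk u ((u, w) # p) v" "length p = n"
      by (auto simp: awalk_Cons_iff)
    then show "\<exists>p. awalk u p v \<and> length p = Suc n"
      by (metis length_Cons)
  qed
  also have "\<dots> \<longleftrightarrow> (\<exists>w. (u, w) \<in> parcs G \<and> (w, v) \<in> parcs G ^^ n)"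
  proof -
    have "(\<exists>p. awalk w p v \<and> length p = n) \<longleftrightarrow> (w, v) \<in> parcs G ^^ n"
      if "(u, w) \<in> parcs G" for w
      using Suc.IH[OF in_arcsD2[OF that]] .
    then show ?thesis by blast
  qed
  also have "\<dots> \<longleftrightarrow> (u, v) \<in> parcs G ^^ Suc n"
    by (metis relpow_Suc_D2 relpow_Suc_I2)
  finally show ?case .
qed

lemma (in pair_wf_digraph) graph_dist_eq_rdist:
  "u \<in> pverts G \<Longrightarrow> graph_dist G u v = rdist (parcs G) u v"
  unfolding graph_dist_def rdist_def by (subst ex_awalk_iff_relpow) auto

lemma (in pair_wf_digraph) relpow_imp_short_apath:
  assumes "(u, v) \<in> parcs G ^^ n" "u \<in> pverts G"
  obtains p where "apath u p v" "length p \<le> n"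
proof -
  obtain p where p: "awalk u p v" "length p = n"
    using assms ex_awalk_iff_relpow by blast
  \<comment> \<open>With unit weights, the cost bound for removing closed subwalks becomes a bound
    on the length.\<close>
  have cost: "awalk_cost (\<lambda>_. 1) p = real (length p)" for p :: "('a \<times> 'a) list"
    by (induction p) auto
  have "awalk_cost (\<lambda>_. 1) (awalk_to_apath p) \<le> awalk_cost (\<lambda>_. 1) p"
    using p(1) by (intro awalk_to_path_no_neg_cyc_cost[of u _ v]) (auto simp: cost)
  then show ?thesis
    using that[of "awalk_to_apath p"] apath_awalk_to_apath[OF p(1)] p(2) by (simp add: cost)
qed

lemma (in pair_graph) girth_le:
  assumes "(w, x) \<in> parcs G" "(w, y) \<in> parcs G" "x \<noteq> y"
    and "(x, y) \<in> (parcs G \<inter> (- {w}) \<times> (- {w})) ^^ n"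
  shows "girth G \<le> enat (n + 2)"
proof -
  \<comment> \<open>A path extracted inside the graph without \<open>w\<close> avoids
    \<open>w\<close>, so closing it up through \<open>w\<close> keeps the vertices of the cycle
    distinct.\<close>
  define H where "H = \<lparr> pverts = pverts G - {w}, parcs = parcs G \<inter> (- {w}) \<times> (- {w}) \<rparr>"
  interpret H: pair_wf_digraph H
    by unfold_locales (auto simp: H_def dest: wellformed')
  have "x \<in> pverts H"
    using assms(1) by (auto simp: H_def dest: wellformed' no_loops')
  with assms(4) obtain p where p: "H.apath x p y" "length p \<le> n"
    using H.relpow_imp_short_apath[of x y n] by (auto simp: H_def)
  have aw: "H.awalk x p y" and dist: "distinct (pawalk_verts x p)"
    using p(1) by (auto simp: H.apath_def)
  have w: "w \<notin> set (pawalk_verts x p)"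
  proof -
    have "set (pawalk_verts x p) \<subseteq> pverts H"
      using aw by (rule H.awalkE')
    then show ?thesis by (auto simp: H_def)
  qed
  have awG: "awalk x p y"
    using aw unfolding H.awalk_def awalk_def by (auto simp: H_def)
  let ?c = "(w, x) # p @ [(y, w)]"
  have "awalk w ?c w"
    using awG assms arcs_symmetric[OF assms(2)]
    by (auto simp: awalk_Cons_iff awalk_Nil_iff wellformed')
  moreover have "distinct (tl (pawalk_verts w ?c))"
  proof -
    have "pawalk_verts x (p @ [(y, w)]) = pawalk_verts x p @ [w]"
      using awalk_verts_append[of x p "[(y, w)]" w] awG \<open>awalk w ?c w\<close>
      by (auto simp: awalk_Cons_iff)
    then show ?thesis using dist w by simp
  qed
  ultimately have "cycle ?c"
    unfolding cycle_def by blast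
  \<comment> \<open>Since \<open>x \<noteq> y\<close>, the path is not empty, which excludes the
    degenerate closed walk \<open>w, x, w\<close>.\<close>
  moreover have "length ?c \<ge> 3"
    using p(1) \<open>x \<noteq> y\<close> by (cases p) (auto simp: H.apath_Nil_iff)
  ultimately have "girth G \<le> enat (length ?c)"
    unfolding girth_def by (intro INF_lower) auto
  also have "\<dots> \<le> enat (n + 2)"
    using p(2) by simp
  finally show ?thesis .
qed

section \<open>Distances from a vertex of a Moore graph of even girth\<close>

lemma double_count:
  assumes "finite A" "finite B"
  shows "(\<Sum>x\<in>A. card {y \<in> B. R x y}) = (\<Sum>y\<in>B. card {x \<in> A. R x y})"
proof -
  have "card {y \<in> B. R x y} = (\<Sum>y\<in>B. if R x y then 1 else 0)" for x
    using \<open>finite B\<close> by (simp add: sum.If_cases Int_def)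
  moreover have "card {x \<in> A. R x y} = (\<Sum>x\<in>A. if R x y then 1 else 0)" for y
    using \<open>finite A\<close> by (simp add: sum.If_cases Int_def)
  ultimately show ?thesis by (simp add: sum.swap[of _ A])
qed

text \<open>\<open>no_short_cycle\<close> says that the girth is at least \<open>2 d\<close>: a walk from \<open>x\<close> to \<open>y\<close>
  avoiding \<open>w\<close> contains a path, which closes up through \<open>w\<close> to a cycle.\<close>

locale even_moore =
  fixes V :: "'a set" and E :: "('a \<times> 'a) set" and k d :: nat
  assumes finite_V: "finite V" and V_ne: "V \<noteq> {}" and E_sub: "E \<subseteq> V \<times> V"
    and sym_E: "sym E" and irrefl_E: "(x, x) \<notin> E"
    and conn: "u \<in> V \<Longrightarrow> v \<in> V \<Longrightarrow> (u, v) \<in> E\<^sup>*"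
    and k_ge: "3 \<le> k" and d_ge: "2 \<le> d"
    and regular: "v \<in> V \<Longrightarrow> card (E `` {v}) = k"
    and no_short_cycle:
      "(w, x) \<in> E \<Longrightarrow> (w, y) \<in> E \<Longrightarrow> x \<noteq> y \<Longrightarrow>
        (x, y) \<in> (E \<inter> (- {w}) \<times> (- {w})) ^^ n \<Longrightarrow> 2 * d \<le> n + 2"
    and card_V: "card V = 1 + (\<Sum>i<d - 1. k * (k - 1) ^ i) + (k - 1) ^ (d - 1)"
begin

abbreviation \<delta> where "\<delta> \<equiv> rdist E"

lemma E_in: "(x, y) \<in> E \<Longrightarrow> x \<in> V" "(x, y) \<in> E \<Longrightarrow> y \<in> V"
  using E_sub by auto

lemma E_sym: "(x, y) \<in> E \<Longrightarrow> (y, x) \<in> E"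
  using sym_E by (auto dest: symD)

lemma finite_nbrs [simp]: "finite (E `` {v})" "finite {x. (v, x) \<in> E}"
  "finite {x. (v, x) \<in> E \<and> P x}" "finite {x \<in> V. P x}"
  by (rule finite_subset[OF _ finite_V]; use E_in in auto)+

lemma dist_sym: "\<delta> u v = \<delta> v u"
  using sym_E by (rule rdist_sym)

lemma dist_relpow: "u \<in> V \<Longrightarrow> v \<in> V \<Longrightarrow> (u, v) \<in> E ^^ \<delta> u v"
  using conn by (intro relpow_rdist)

lemma dist_self [simp]: "\<delta> u u = 0"
  using rdist_le[of u u 0 E] by simp

lemma dist_eq_0_iff: "u \<in> V \<Longrightarrow> v \<in> V \<Longrightarrow> \<delta> u v = 0 \<longleftrightarrow> u = v"
  using dist_relpow[of u v] by auto

lemma dist_step: "u \<in> V \<Longrightarrow> (x, y) \<in> E \<Longrightarrow> \<delta> u y \<le> Suc (\<delta> u x)"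
  using dist_relpow[of u x] E_in by (auto intro!: rdist_le)

lemma dist_pred:
  assumes "u \<in> V" "y \<in> V" "\<delta> u y = Suc m"
  obtains x where "(x, y) \<in> E" "\<delta> u x = m"
proof -
  obtain x where x: "(u, x) \<in> E ^^ m" "(x, y) \<in> E"
    using dist_relpow[OF assms(1,2)] assms(3) by auto
  then have "\<delta> u x = m"
    using dist_step[OF assms(1) x(2)] rdist_le[OF x(1)] assms(3) by simp
  then show ?thesis using x that by blast
qed

text \<open>Distances from \<open>v\<close> increase strictly along a geodesic, so every vertex
  before \<open>x\<close> is closer to \<open>v\<close> than \<open>w\<close> is.\<close>

lemma geodesic_avoids:
  assumes "v \<in> V" "x \<in> V" "x \<noteq> w" "\<delta> v x \<le> \<delta> v w" "v \<noteq> w"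
  shows "(v, x) \<in> (E \<inter> (- {w}) \<times> (- {w})) ^^ \<delta> v x"
proof -
  have "\<delta> v x = n \<Longrightarrow> (v, x) \<in> (E \<inter> (- {w}) \<times> (- {w})) ^^ n" for n
    using assms
  proof (induction n arbitrary: x)
    case 0
    then show ?case using dist_eq_0_iff by auto
  next
    case (Suc n)
    then obtain y where y: "(y, x) \<in> E" "\<delta> v y = n"
      using dist_pred by metis
    then have "y \<noteq> w" "y \<in> V" using Suc.prems E_in by auto
    then show ?case using Suc y by (intro relpow_Suc_I[of _ y]) auto
  qed
  then show ?thesis by simp
qed

text \<open>Geodesics from \<open>v\<close> to \<open>x\<close> and to \<open>y\<close> avoid
  \<open>w\<close>; joined at \<open>v\<close> they form the walk that \<open>no_short_cycle\<close>
  asks for. The tree structure below depth \<open>d\<close> rests on this inequality.\<close>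

lemma two_short_nbrs:
  assumes "v \<in> V" "(w, x) \<in> E" "(w, y) \<in> E" "x \<noteq> y" "\<delta> v x \<le> \<delta> v w" "\<delta> v y \<le> \<delta> v w"
  shows "2 * d \<le> \<delta> v x + \<delta> v y + 2"
proof (cases "v = w")
  case True
  then show ?thesis using assms dist_eq_0_iff[of w x] dist_eq_0_iff[of w y] E_in by auto
next
  case False
  let ?A = "E \<inter> (- {w}) \<times> (- {w})"
  have "sym ?A" using sym_E by (auto simp: sym_def)
  moreover have ne: "x \<noteq> w" "y \<noteq> w" using assms irrefl_E by auto
  ultimately have "(x, v) \<in> ?A ^^ \<delta> v x" "(v, y) \<in> ?A ^^ \<delta> v y"
    using geodesic_avoids[of v x w] geodesic_avoids[of v y w] False assms E_in
      relpow_sym[of ?A v x] by auto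
  then have "(x, y) \<in> ?A ^^ (\<delta> v x + \<delta> v y)"
    by (auto simp: relpow_add)
  then show ?thesis
    using no_short_cycle[of w x y] assms by auto
qed

text \<open>Two distinct such neighbours are at distance at most \<open>d - 2\<close> from
  \<open>v\<close>, so \<open>two_short_nbrs\<close> would give
  \<open>2 * d \<le> 2 * d - 2\<close>.\<close>

lemma down_unique:
  assumes "v \<in> V" "(w, x) \<in> E" "(w, y) \<in> E" "\<delta> v w < d" "\<delta> v x < \<delta> v w" "\<delta> v y < \<delta> v w"
  shows "x = y"
proof (rule ccontr)
  assume "x \<noteq> y"
  then have "2 * d \<le> \<delta> v x + \<delta> v y + 2"
    using assms by (intro two_short_nbrs[of v w x y]) simp_all
  then show False using assms(4-6) by linarith
qed

text \<open>A neighbour on the level \<open>i\<close> of \<open>w\<close> together with a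
  predecessor of \<open>w\<close> on level \<open>i - 1\<close> would give
  \<open>2 * d \<le> 2 * i + 1\<close>, impossible for \<open>i < d\<close>.\<close>

lemma no_lateral_inner:
  assumes "v \<in> V" "(w, x) \<in> E" "\<delta> v w < d"
  shows "\<delta> v x \<noteq> \<delta> v w"
proof
  assume eq: "\<delta> v x = \<delta> v w"
  show False
  proof (cases "\<delta> v w")
    case 0
    then show False using eq assms dist_eq_0_iff E_in irrefl_E by metis
  next
    case (Suc m)
    then obtain y where "(y, w) \<in> E" "\<delta> v y = m"
      using dist_pred assms E_in by metis
    moreover from this have "x \<noteq> y" using eq Suc by auto
    ultimately have "2 * d \<le> \<delta> v x + \<delta> v y + 2"
      using assms eq Suc E_sym by (intro two_short_nbrs[of v w x y]) simp_all
    then show False using \<open>\<delta> v y = m\<close> assms(3) eq Suc by linarith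
  qed
qed

lemma card_down:
  assumes "v \<in> V" "w \<in> V" "\<delta> v w = Suc i" "Suc i < d"
  shows "card {x. (w, x) \<in> E \<and> \<delta> v x = i} = 1"
proof -
  obtain y where y: "(y, w) \<in> E" "\<delta> v y = i"
    using dist_pred assms by metis
  then have "{x. (w, x) \<in> E \<and> \<delta> v x = i} = {y}"
    using down_unique[of v w _ y] assms E_sym by auto
  then show ?thesis by simp
qed

lemma card_up:
  assumes "v \<in> V" "w \<in> V" "\<delta> v w = i" "i < d"
  shows "card {x. (w, x) \<in> E \<and> \<delta> v x = Suc i} = (if i = 0 then k else k - 1)"
proof -
  \<comment> \<open>Writing \<open>Suc (\<delta> v x) = i\<close> instead of
    \<open>\<delta> v x = i - 1\<close> makes \<open>?D\<close> empty for \<open>i = 0\<close>,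
    where truncated subtraction would be wrong.\<close>
  let ?D = "{x. (w, x) \<in> E \<and> Suc (\<delta> v x) = i}" and ?U = "{x. (w, x) \<in> E \<and> \<delta> v x = Suc i}"
  have "\<delta> v x = Suc i \<or> Suc (\<delta> v x) = i" if "(w, x) \<in> E" for x
    using no_lateral_inner[of v w x] dist_step[of v w x] dist_step[of v x w] that assms E_sym
    by fastforce
  then have "E `` {w} = ?D \<union> ?U" by auto
  then have "k = card (?D \<union> ?U)" using regular[of w] assms(2) by argo
  also have "\<dots> = card ?D + card ?U" by (intro card_Un_disjoint) auto
  also have "card ?D = (if i = 0 then 0 else 1)"
    using card_down[of v w "i - 1"] assms by (cases i) auto
  finally show ?thesis by auto
qed

definition level :: "'a \<Rightarrow> nat \<Rightarrow> 'a set" where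
  "level v i = {w \<in> V. \<delta> v w = i}"

lemma finite_level [simp]: "finite (level v i)"
  by (simp add: level_def)

text \<open>Arcs between consecutive levels, counted from both ends. The upper count stays a sum
  because its terms are 1 only below level \<open>d\<close>; the case \<open>i = d - 1\<close> is
  used for the top level.\<close>

lemma card_level_Suc:
  assumes "v \<in> V" "i < d"
  shows "card (level v i) * (if i = 0 then k else k - 1) =
    (\<Sum>y\<in>level v (Suc i). card {x. (y, x) \<in> E \<and> \<delta> v x = i})"
proof -
  have "(\<Sum>x\<in>level v i. card {y \<in> level v (Suc i). (x, y) \<in> E}) =
      (\<Sum>y\<in>level v (Suc i). card {x \<in> level v i. (x, y) \<in> E})"
    by (rule double_count) auto
  moreover have "{y \<in> level v (Suc i). (x, y) \<in> E} = {y. (x, y) \<in> E \<and> \<delta> v y = Suc i}" for x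
    using E_in by (auto simp: level_def)
  moreover have "{x \<in> level v i. (x, y) \<in> E} = {x. (y, x) \<in> E \<and> \<delta> v x = i}" for y
    using E_in E_sym by (auto simp: level_def)
  moreover have "(\<Sum>x\<in>level v i. card {y. (x, y) \<in> E \<and> \<delta> v y = Suc i}) =
      card (level v i) * (if i = 0 then k else k - 1)"
    using card_up[of v _ i] assms by (simp add: level_def)
  ultimately show ?thesis by simp
qed

lemma level_0: "v \<in> V \<Longrightarrow> level v 0 = {v}"
  by (auto simp: level_def dist_eq_0_iff)

lemma card_level:
  assumes "v \<in> V" "Suc i < d"
  shows "card (level v (Suc i)) = k * (k - 1) ^ i"
  using assms(2)
proof (induction i)
  case 0
  then have "card (level v (Suc 0)) = (\<Sum>y\<in>level v (Suc 0). card {x. (y, x) \<in> E \<and> \<delta> v x = 0})"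
    using card_down[of v _ 0] assms by (simp add: level_def)
  then show ?case
    using card_level_Suc[of v 0] assms level_0 by simp
next
  case (Suc i)
  then have "card (level v (Suc (Suc i))) =
      (\<Sum>y\<in>level v (Suc (Suc i)). card {x. (y, x) \<in> E \<and> \<delta> v x = Suc i})"
    using card_down[of v _ "Suc i"] assms by (simp add: level_def)
  then show ?case
    using card_level_Suc[of v "Suc i"] assms Suc by (simp add: mult_ac)
qed

lemma card_inner: "v \<in> V \<Longrightarrow> card {w \<in> V. \<delta> v w < d} = 1 + (\<Sum>i<d - 1. k * (k - 1) ^ i)"
proof -
  assume v: "v \<in> V"
  have "{w \<in> V. \<delta> v w < d} = (\<Union>i<d. level v i)" by (auto simp: level_def)
  also have "card \<dots> = (\<Sum>i<d. card (level v i))"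
    by (intro card_UN_disjoint) (auto simp: level_def)
  also have "\<dots> = (\<Sum>i<Suc (d - 1). card (level v i))"
    using d_ge by simp
  also have "\<dots> = card (level v 0) + (\<Sum>i<d - 1. card (level v (Suc i)))"
    by (rule sum.lessThan_Suc_shift)
  finally show ?thesis
    using v level_0 card_level by simp
qed

text \<open>The inner levels account for all of the Moore bound except its last summand. This is
  where attaining the bound enters.\<close>

lemma card_outer: "v \<in> V \<Longrightarrow> card {w \<in> V. d \<le> \<delta> v w} = (k - 1) ^ (d - 1)"
proof -
  assume v: "v \<in> V"
  have "V = {w \<in> V. \<delta> v w < d} \<union> {w \<in> V. d \<le> \<delta> v w}" by auto
  then have "card V = card {w \<in> V. \<delta> v w < d} + card {w \<in> V. d \<le> \<delta> v w}"
    using card_Un_disjoint[of "{w \<in> V. \<delta> v w < d}" "{w \<in> V. d \<le> \<delta> v w}"] by fastforce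
  then show ?thesis
    using card_inner[OF v] card_V by simp
qed

lemma card_nbrs_le: "w \<in> V \<Longrightarrow> card {x. (w, x) \<in> E \<and> P x} \<le> k"
proof -
  assume "w \<in> V"
  moreover have "card {x. (w, x) \<in> E \<and> P x} \<le> card (E `` {w})"
    by (intro card_mono) auto
  ultimately show ?thesis using regular by simp
qed

text \<open>The \<open>k (k - 1)\<^sup>d\<^sup>-\<^sup>1\<close> arcs leaving level \<open>d - 1\<close> upwards exhaust all
  the arcs at the remaining \<open>(k - 1)\<^sup>d\<^sup>-\<^sup>1\<close> vertices.\<close>

lemma outer_nbrs:
  assumes "v \<in> V" "w \<in> V" "d \<le> \<delta> v w"
  shows "\<delta> v w = d \<and> (\<forall>x. (w, x) \<in> E \<longrightarrow> \<delta> v x = d - 1)"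
proof -
  let ?W = "{w \<in> V. d \<le> \<delta> v w}" and ?D = "\<lambda>y. {x. (y, x) \<in> E \<and> \<delta> v x = d - 1}"
  obtain m where m: "d = Suc (Suc m)" using that[of "d - 2"] d_ge by simp
  have W: "finite ?W" "w \<in> ?W" using assms by auto
  have "(\<Sum>y\<in>level v d. card (?D y)) = k * (k - 1) ^ (d - 1)"
    using card_level_Suc[of v "d - 1"] card_level[of v m] assms by (simp add: m mult_ac)
  \<comment> \<open>At this point \<open>?W\<close> might still contain vertices farther away than
    \<open>d\<close>; they are excluded only by the outcome of the count.\<close>
  moreover have "(\<Sum>y\<in>level v d. card (?D y)) \<le> (\<Sum>y\<in>?W. card (?D y))"
    by (rule sum_mono2[OF W(1)]) (auto simp: level_def)
  moreover have "(\<Sum>y\<in>?W. k) = k * (k - 1) ^ (d - 1)"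
    using card_outer[OF assms(1)] by simp
  ultimately have ge: "(\<Sum>y\<in>?W. k) \<le> (\<Sum>y\<in>?W. card (?D y))" by argo
  \<comment> \<open>Each term is at most \<open>k\<close> and the total is at least that of the
    constant \<open>k\<close>, so no vertex of \<open>?W\<close> can fall short.\<close>
  have full: "card (?D w) = k"
  proof (rule ccontr)
    assume "card (?D w) \<noteq> k"
    then have "card (?D w) < k" using card_nbrs_le[OF assms(2), of "\<lambda>x. \<delta> v x = d - 1"] by linarith
    then have "(\<Sum>y\<in>?W. card (?D y)) < (\<Sum>y\<in>?W. k)"
      by (intro sum_strict_mono_ex1[OF W(1)] ballI bexI[OF _ W(2)] card_nbrs_le) auto
    then show False using ge by linarith
  qed
  moreover have "?D w \<subseteq> E `` {w}" by auto
  ultimately have D: "?D w = E `` {w}"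
    using regular[OF assms(2)] by (intro card_subset_eq) auto
  have "?D w \<noteq> {}"
  proof
    assume empty: "?D w = {}"
    show False using full k_ge unfolding empty by simp
  qed
  then obtain x where x: "(w, x) \<in> E" "\<delta> v x = d - 1" by blast
  have "\<delta> v w \<le> d"
    using dist_step[OF assms(1) E_sym[OF x(1)]] x(2) m by simp
  then show ?thesis using D assms(3) by auto
qed

lemma dist_le: "v \<in> V \<Longrightarrow> w \<in> V \<Longrightarrow> \<delta> v w \<le> d"
  using outer_nbrs[of v w] by linarith

lemma card_level_top: "v \<in> V \<Longrightarrow> card (level v d) = (k - 1) ^ (d - 1)"
proof -
  assume v: "v \<in> V"
  then have "level v d = {w \<in> V. d \<le> \<delta> v w}" using outer_nbrs by (auto simp: level_def)
  then show ?thesis using card_outer v by simp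
qed

text \<open>Together with \<open>dist_le\<close> this identifies the diameter as
  \<open>d\<close>.\<close>

lemma ex_dist_d: "\<exists>v\<in>V. \<exists>w\<in>V. \<delta> v w = d"
proof -
  obtain v where v: "v \<in> V" using V_ne by blast
  then have "card (level v d) \<noteq> 0" using card_level_top k_ge by simp
  then have "level v d \<noteq> {}" by fastforce
  then show ?thesis using v by (auto simp: level_def)
qed

text \<open>This amounts to bipartiteness: the parity of \<open>\<delta> v\<close> is a proper
  2-colouring.\<close>

lemma no_lateral:
  assumes "v \<in> V" "(w, x) \<in> E"
  shows "\<delta> v x \<noteq> \<delta> v w"
proof (cases "\<delta> v w < d")
  case True
  then show ?thesis using no_lateral_inner assms by blast
next
  case False
  then have "\<delta> v w = d" "\<delta> v x = d - 1"
    using outer_nbrs[OF assms(1) E_in(1)[OF assms(2)]] assms(2) by auto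
  then show ?thesis using d_ge by linarith
qed

end

section \<open>Distances from an edge\<close>

lemma (in even_moore) sum_by_value:
  fixes g :: "nat \<Rightarrow> real"
  assumes "\<And>w. w \<in> V \<Longrightarrow> l w < n"
  shows "(\<Sum>w\<in>V. g (l w)) = (\<Sum>i<n. real (card {w \<in> V. l w = i}) * g i)"
proof -
  have "(\<Sum>w\<in>V. g (l w)) = (\<Sum>i<n. \<Sum>w\<in>{w \<in> V. l w = i}. g (l w))"
    using assms finite_V by (intro sum.group[symmetric]) auto
  also have "\<dots> = (\<Sum>i<n. real (card {w \<in> V. l w = i}) * g i)"
    by (intro sum.cong) auto
  finally show ?thesis .
qed

definition edges :: "('a \<times> 'a) set \<Rightarrow> 'a set set" where
  "edges E = {{u, v} | u v. (u, v) \<in> E}"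

context even_moore
begin

abbreviation q :: real where "q \<equiv> real k - 1"

lemma real_k_minus_1: "real (k - 1) = q"
  using k_ge by simp

text \<open>The weight \<open>g\<close> is arbitrary because distances to old vertices and, via
  \<open>sum_edges\<close>, to new ones are both summed this way. The top level is separate: it has
  \<open>q ^ (d - 1)\<close> vertices, not \<open>k * q ^ (d - 1)\<close>.\<close>

lemma sum_dist_vertex:
  fixes g :: "nat \<Rightarrow> real"
  assumes "v \<in> V"
  shows "(\<Sum>w\<in>V. g (\<delta> v w)) = g 0 + (\<Sum>i<d - 1. k * q ^ i * g (Suc i)) + q ^ (d - 1) * g d"
proof -
  obtain m where m: "d = Suc m" using d_ge by (cases d) auto
  have "(\<Sum>w\<in>V. g (\<delta> v w)) = (\<Sum>i<Suc d. real (card (level v i)) * g i)"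
    using dist_le[OF assms] unfolding level_def by (intro sum_by_value) (simp add: less_Suc_eq_le)
  also have "\<dots> = (\<Sum>i<Suc m. real (card (level v i)) * g i) + q ^ (d - 1) * g d"
    using card_level_top[OF assms] real_k_minus_1 by (simp add: m)
  also have "(\<Sum>i<Suc m. real (card (level v i)) * g i) =
      g 0 + (\<Sum>i<m. real (card (level v (Suc i))) * g (Suc i))"
    using level_0[OF assms] by (subst sum.lessThan_Suc_shift) simp
  also have "(\<Sum>i<m. real (card (level v (Suc i))) * g (Suc i)) = (\<Sum>i<m. k * q ^ i * g (Suc i))"
    using card_level[OF assms] real_k_minus_1 m by (intro sum.cong) simp_all
  finally show ?thesis by (simp add: m)
qed

text \<open>Every edge carries two arcs. Sums over edges thereby reduce to sums over neighbourhoods,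
  where the local counts apply.\<close>

lemma sum_edges:
  fixes h :: "'a set \<Rightarrow> real"
  shows "2 * (\<Sum>e\<in>edges E. h e) = (\<Sum>w\<in>V. \<Sum>x\<in>E `` {w}. h {w, x})"
proof -
  let ?e = "\<lambda>p. {fst p, snd p}"
  have fin: "finite E" using finite_V E_sub finite_subset by blast
  have eq: "edges E = ?e ` E" by (auto simp: edges_def image_iff) (metis fst_conv snd_conv)+
  have "(\<Sum>w\<in>V. \<Sum>x\<in>E `` {w}. h {w, x}) = (\<Sum>p\<in>(SIGMA w:V. E `` {w}). h (?e p))"
    using finite_V by (subst sum.Sigma) (auto simp: case_prod_beta)
  also have "(SIGMA w:V. E `` {w}) = E" using E_in by auto
  also have "(\<Sum>p\<in>E. h (?e p)) = (\<Sum>e\<in>edges E. \<Sum>p\<in>{p \<in> E. ?e p = e}. h (?e p))"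
    using fin by (intro sum.group[symmetric]) (auto simp: eq)
  also have "\<dots> = (\<Sum>e\<in>edges E. 2 * h e)"
  proof (intro sum.cong refl)
    fix e assume "e \<in> edges E"
    then obtain u v where e: "e = {u, v}" "(u, v) \<in> E" by (auto simp: edges_def)
    have "u \<noteq> v" using e irrefl_E by blast
    moreover have "{p \<in> E. ?e p = e} = {(u, v), (v, u)}"
      using e E_sym by (auto simp: doubleton_eq_iff)
    ultimately show "(\<Sum>p\<in>{p \<in> E. ?e p = e}. h (?e p)) = 2 * h e"
      using e by (simp add: insert_commute)
  qed
  finally show ?thesis by (simp add: sum_distrib_left)
qed

text \<open>Made for the tree-like levels: one neighbour is closer to the source and the other
  \<open>q\<close> share a single value.\<close>

lemma sum_nbrs_one_exception:
  fixes h :: "'a \<Rightarrow> real"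
  assumes "w \<in> V" "card {x. (w, x) \<in> E \<and> P x} = 1"
    and "\<And>x. (w, x) \<in> E \<Longrightarrow> P x \<Longrightarrow> h x = s"
    and "\<And>x. (w, x) \<in> E \<Longrightarrow> \<not> P x \<Longrightarrow> h x = t"
  shows "(\<Sum>x\<in>E `` {w}. h x) = s + q * t"
proof -
  obtain y where y: "{x. (w, x) \<in> E \<and> P x} = {y}"
    using assms(2) by (rule card_1_singletonE)
  then have yE: "y \<in> E `` {w}" "h y = s" using assms(3) by auto
  have "(\<Sum>x\<in>E `` {w} - {y}. h x) = (\<Sum>x\<in>E `` {w} - {y}. t)"
    using y assms(4) by (intro sum.cong) auto
  also have "\<dots> = q * t"
    using yE regular[OF assms(1)] real_k_minus_1 by (simp add: card_Diff_singleton)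
  finally show ?thesis
    using yE by (subst sum.remove[of _ y]) auto
qed

definition edist :: "'a \<Rightarrow> 'a \<Rightarrow> 'a \<Rightarrow> nat" where
  "edist a b w = min (\<delta> a w) (\<delta> b w)"

lemma edist_commute: "edist a b w = edist b a w"
  by (simp add: edist_def)

text \<open>By \<open>no_lateral\<close> seen from \<open>w\<close>, the two ends lie on consecutive
  levels around \<open>w\<close>, so each vertex belongs to exactly one side of the edge.\<close>

lemma edist_cases:
  assumes "(a, b) \<in> E" "w \<in> V"
  obtains "\<delta> a w = edist a b w" "\<delta> b w = Suc (edist a b w)"
    | "\<delta> b w = edist a b w" "\<delta> a w = Suc (edist a b w)"
proof -
  have "\<delta> a w \<noteq> \<delta> b w" "\<delta> a w \<le> Suc (\<delta> b w)" "\<delta> b w \<le> Suc (\<delta> a w)"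
    using no_lateral[of w a b] dist_step[of w a b] dist_step[of w b a] assms E_sym dist_sym[of _ w]
    by auto
  then show ?thesis using that unfolding edist_def by linarith
qed

lemma edist_less:
  assumes "(a, b) \<in> E" "w \<in> V"
  shows "edist a b w < d"
  using edist_cases[OF assms] dist_le[of a w] dist_le[of b w] E_in[OF assms(1)] assms(2)
  by (metis Suc_le_eq)

lemma edist_step:
  assumes "(a, b) \<in> E" "(x, y) \<in> E"
  shows "edist a b y \<le> Suc (edist a b x)"
  using dist_step[of a x y] dist_step[of b x y] E_in[OF assms(1)] assms(2)
  unfolding edist_def by auto

lemma edist_eq_0_iff:
  assumes "(a, b) \<in> E" "w \<in> V"
  shows "edist a b w = 0 \<longleftrightarrow> w \<in> {a, b}"
  using dist_eq_0_iff[of a w] dist_eq_0_iff[of b w] E_in[OF assms(1)] assms(2)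
  unfolding edist_def by auto

text \<open>The far end \<open>b\<close> is at distance \<open>i + 2\<close>, so stepping from
  \<open>w\<close> cannot bring it below \<open>i + 1\<close> and only \<open>\<delta> a\<close>
  decides. Since \<open>i + 2 \<le> d\<close>, the count around \<open>a\<close> applies.\<close>

lemma card_edist_down_aux:
  assumes "(a, b) \<in> E" "w \<in> V" "\<delta> a w = Suc i" "\<delta> b w = Suc (Suc i)"
  shows "card {x. (w, x) \<in> E \<and> edist a b x = i} = 1"
proof -
  note ab = E_in[OF assms(1)]
  have "edist a b x = i \<longleftrightarrow> \<delta> a x = i" if "(w, x) \<in> E" for x
    using dist_step[OF ab(2) E_sym[OF that]] dist_step[OF ab(1) E_sym[OF that]] assms(3,4)
    unfolding edist_def by linarith
  then have "{x. (w, x) \<in> E \<and> edist a b x = i} = {x. (w, x) \<in> E \<and> \<delta> a x = i}" by blast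
  moreover have "Suc i < d" using dist_le[OF ab(2) assms(2)] assms(4) by simp
  ultimately show ?thesis using card_down[OF ab(1) assms(2,3)] by simp
qed

lemma card_edist_down:
  assumes "(a, b) \<in> E" "w \<in> V" "edist a b w = Suc i"
  shows "card {x. (w, x) \<in> E \<and> edist a b x = i} = 1"
  using assms(1,2)
proof (cases rule: edist_cases)
  case 1
  then show ?thesis using card_edist_down_aux[of a b w i] assms by simp
next
  case 2
  then show ?thesis
    using card_edist_down_aux[of b a w i] assms E_sym by (simp add: edist_commute[of a b])
qed

lemma card_edist_up_aux:
  assumes "(a, b) \<in> E" "w \<in> V" "\<delta> a w = i" "\<delta> b w = Suc i" "Suc i < d"
  shows "card {x. (w, x) \<in> E \<and> edist a b x = Suc i} = k - 1"
proof (cases i)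
  case 0
  then have "w = a" using dist_eq_0_iff E_in assms by metis
  have "{x. (w, x) \<in> E \<and> edist a b x = Suc i} = E `` {a} - {b}"
  proof (intro equalityI subsetI)
    fix x assume "x \<in> {x. (w, x) \<in> E \<and> edist a b x = Suc i}"
    then show "x \<in> E `` {a} - {b}" using \<open>w = a\<close> by (auto simp: edist_def)
  next
    fix x assume x: "x \<in> E `` {a} - {b}"
    then have "(a, x) \<in> E" "x \<noteq> b" "x \<noteq> a" using irrefl_E by auto
    then have "edist a b x \<noteq> 0" "edist a b x \<le> Suc (edist a b a)"
      using edist_eq_0_iff[OF assms(1), of x] edist_step[OF assms(1), of a x] E_in by auto
    moreover have "edist a b a = 0" by (simp add: edist_def)
    ultimately have "edist a b x = Suc 0" by linarith
    then show "x \<in> {x. (w, x) \<in> E \<and> edist a b x = Suc i}"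
      using \<open>w = a\<close> 0 \<open>(a, x) \<in> E\<close> by simp
  qed
  then show ?thesis using regular[of a] assms(1) E_in by simp
next
  case (Suc j)
  note ab = E_in[OF assms(1)]
  obtain z where z: "(z, w) \<in> E" "\<delta> a z = j"
    using dist_pred[OF ab(1) assms(2)] assms(3) Suc by metis
  \<comment> \<open>The predecessor \<open>z\<close> of \<open>w\<close> towards \<open>a\<close> is
    also one step closer to \<open>b\<close>. By \<open>down_unique\<close> it is the only such
    neighbour, so a neighbour farther from \<open>a\<close> does not get closer to
    \<open>b\<close>.\<close>
  have zb: "\<delta> b z = i"
    using dist_step[OF ab(2) z(1)] dist_step[of z a b] dist_sym[of z] z assms E_in Suc by auto
  have "edist a b x = Suc i \<longleftrightarrow> \<delta> a x = Suc i" if x: "(w, x) \<in> E" for x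
  proof
    assume "edist a b x = Suc i"
    then show "\<delta> a x = Suc i"
      using dist_step[OF ab(1) x] assms(3) unfolding edist_def by linarith
  next
    assume ax: "\<delta> a x = Suc i"
    have "\<delta> b x \<noteq> i"
    proof
      assume "\<delta> b x = i"
      then have "x = z"
        using down_unique[OF ab(2) x E_sym[OF z(1)]] zb assms by simp
      then show False using ax z Suc by simp
    qed
    then have "\<delta> b x \<ge> Suc i"
      using dist_step[OF ab(2) E_sym[OF x]] assms(4) by linarith
    then show "edist a b x = Suc i" using ax by (simp add: edist_def)
  qed
  then have "{x. (w, x) \<in> E \<and> edist a b x = Suc i} = {x. (w, x) \<in> E \<and> \<delta> a x = Suc i}" by blast
  then show ?thesis using card_up[OF ab(1) assms(2,3)] assms(5) Suc by simp
qed

lemma card_edist_up: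
  assumes "(a, b) \<in> E" "w \<in> V" "edist a b w = i" "Suc i < d"
  shows "card {x. (w, x) \<in> E \<and> edist a b x = Suc i} = k - 1"
  using assms(1,2)
proof (cases rule: edist_cases)
  case 1
  then show ?thesis using card_edist_up_aux[of a b w i] assms by simp
next
  case 2
  then show ?thesis
    using card_edist_up_aux[of b a w i] assms E_sym by (simp add: edist_commute[of a b])
qed

text \<open>Two trees with branching \<open>q\<close>, rooted at \<open>a\<close> and
  \<open>b\<close>; each level grows by the factor \<open>q\<close>, again by counting arcs from
  both ends.\<close>

lemma card_edist_level:
  assumes "(a, b) \<in> E" "i < d"
  shows "card {w \<in> V. edist a b w = i} = 2 * (k - 1) ^ i"
  using assms(2)
proof (induction i)
  case 0
  have "{w \<in> V. edist a b w = 0} = {a, b}"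
    using edist_eq_0_iff[OF assms(1)] E_in[OF assms(1)] by auto
  moreover have "a \<noteq> b" using assms irrefl_E by blast
  ultimately show ?case by simp
next
  case (Suc i)
  define L where "L i = {w \<in> V. edist a b w = i}" for i
  have "(\<Sum>x\<in>L i. card {y \<in> L (Suc i). (x, y) \<in> E}) =
      (\<Sum>y\<in>L (Suc i). card {x \<in> L i. (x, y) \<in> E})"
    by (rule double_count) (auto simp: L_def)
  moreover have "{y \<in> L (Suc i). (x, y) \<in> E} = {y. (x, y) \<in> E \<and> edist a b y = Suc i}" for x
    using E_in by (auto simp: L_def)
  moreover have "{x \<in> L i. (x, y) \<in> E} = {x. (y, x) \<in> E \<and> edist a b x = i}" for y
    using E_in E_sym by (auto simp: L_def)
  moreover have "(\<Sum>x\<in>L i. card {y. (x, y) \<in> E \<and> edist a b y = Suc i}) = card (L i) * (k - 1)"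
    using card_edist_up[OF assms(1), of _ i] Suc.prems by (simp add: L_def)
  moreover have "(\<Sum>y\<in>L (Suc i). card {x. (y, x) \<in> E \<and> edist a b x = i}) = card (L (Suc i))"
    using card_edist_down[OF assms(1), of _ i] by (simp add: L_def)
  ultimately have "card (L (Suc i)) = card (L i) * (k - 1)" by simp
  then show ?case using Suc by (simp add: L_def)
qed

lemma sum_edist:
  fixes g :: "nat \<Rightarrow> real"
  assumes "(a, b) \<in> E"
  shows "(\<Sum>w\<in>V. g (edist a b w)) = (\<Sum>i<d. 2 * q ^ i * g i)"
proof -
  have "(\<Sum>w\<in>V. g (edist a b w)) = (\<Sum>i<d. real (card {w \<in> V. edist a b w = i}) * g i)"
    using edist_less[OF assms] by (rule sum_by_value)
  also have "\<dots> = (\<Sum>i<d. 2 * q ^ i * g i)"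
    using card_edist_level[OF assms] real_k_minus_1 by (intro sum.cong) simp_all
  finally show ?thesis .
qed

end

section \<open>The closed forms \<open>S1'\<close> and \<open>S2'\<close> as sums\<close>

lemma S1'_eq_sum:
  assumes "k \<ge> 3"
  shows "S1' k (Suc n) = (\<Sum>i<n. real (Suc i) * (real k - 1) ^ i)"
proof -
  \<comment> \<open>Clearing the denominator leaves a polynomial identity that a plain induction on
    \<open>n\<close> proves.\<close>
  have "(real k - 2)\<^sup>2 * (\<Sum>i<n. real (Suc i) * (real k - 1) ^ i) =
      (real k * real (Suc n) - 2 * real (Suc n) - real k + 1) * (real k - 1) ^ n + 1"
    by (induction n) (simp_all add: algebra_simps power2_eq_square)
  moreover have "(real k - 2)\<^sup>2 \<noteq> 0" "(2 - real k)\<^sup>2 = (real k - 2)\<^sup>2"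
    using assms by (auto simp: power2_commute)
  ultimately show ?thesis by (simp add: S1'_def field_simps)
qed

lemma S2'_eq_sum:
  assumes "k \<ge> 3"
  shows "S2' k n = (\<Sum>i<n. (2 * real i + 1) * (real k - 1) ^ i)"
proof -
  have "(real k - 2)\<^sup>2 * (\<Sum>i<n. (2 * real i + 1) * (real k - 1) ^ i) =
      (2 * real k * real n - 4 * real n - real k) * (real k - 1) ^ n + real k"
    by (induction n) (simp_all add: algebra_simps power2_eq_square)
  moreover have "(real k - 2)\<^sup>2 \<noteq> 0" "(2 - real k)\<^sup>2 = (real k - 2)\<^sup>2"
    using assms by (auto simp: power2_commute)
  ultimately show ?thesis by (simp add: S2'_def field_simps)
qed

section \<open>The four entries of the quotient matrix\<close>

context even_moore
begin

lemma sum_vertex_vertex: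
  assumes "v \<in> V"
  shows "(\<Sum>w\<in>V. real (2 * \<delta> v w)) = 2 * k * S1' k d + 2 * d * q ^ (d - 1)"
proof -
  have "S1' k d = (\<Sum>i<d - 1. real (Suc i) * q ^ i)"
    using S1'_eq_sum[OF k_ge, of "d - 1"] d_ge by simp
  then show ?thesis
    using sum_dist_vertex[OF assms, of "\<lambda>i. real (2 * i)"]
    by (simp add: sum_distrib_left algebra_simps)
qed

text \<open>The summand is the subdivision distance from \<open>v\<close> to the new vertex on
  \<open>{w, x}\<close>. The cases are \<open>v\<close> itself, an inner vertex with one closer
  neighbour, and the top level, all of whose neighbours are on level \<open>d - 1\<close>.\<close>

lemma sum_nbrs_vertex:
  assumes "v \<in> V" "w \<in> V"
  shows "(\<Sum>x\<in>E `` {w}. real (1 + 2 * min (\<delta> v w) (\<delta> v x))) =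
    (let i = \<delta> v w in if i = 0 then k else if i < d then 2 * real i - 1 + q * (2 * real i + 1)
      else k * (2 * real i - 1))"
proof (cases "\<delta> v w = 0")
  case True
  then show ?thesis using regular[OF assms(2)] by simp
next
  case False
  then obtain j where j: "\<delta> v w = Suc j" by (cases "\<delta> v w") auto
  show ?thesis
  proof (cases "\<delta> v w < d")
    case True
    have "(\<Sum>x\<in>E `` {w}. real (1 + 2 * min (\<delta> v w) (\<delta> v x))) =
        (2 * real (Suc j) - 1) + q * (2 * real (Suc j) + 1)"
    proof (rule sum_nbrs_one_exception[where P = "\<lambda>x. \<delta> v x = j"])
      show "w \<in> V" by fact
      show "card {x. (w, x) \<in> E \<and> \<delta> v x = j} = 1"
        using card_down[OF assms j] True j by simp
    next
      fix x assume "(w, x) \<in> E" "\<delta> v x = j"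
      then show "real (1 + 2 * min (\<delta> v w) (\<delta> v x)) = 2 * real (Suc j) - 1" using j by simp
    next
      fix x assume x: "(w, x) \<in> E" "\<delta> v x \<noteq> j"
      then have "\<delta> v x \<ge> Suc j"
        using dist_step[OF assms(1) E_sym[OF x(1)]] j by simp
      then show "real (1 + 2 * min (\<delta> v w) (\<delta> v x)) = 2 * real (Suc j) + 1" using j by simp
    qed
    then show ?thesis using True j by (simp add: Let_def)
  next
    case False
    then have "\<delta> v w = d" "\<And>x. (w, x) \<in> E \<Longrightarrow> \<delta> v x = d - 1"
      using outer_nbrs[OF assms] by auto
    then have "(\<Sum>x\<in>E `` {w}. real (1 + 2 * min (\<delta> v w) (\<delta> v x))) = (\<Sum>x\<in>E `` {w}. 2 * real d - 1)"
      using d_ge by (intro sum.cong) (auto simp: min_def of_nat_diff)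
    then show ?thesis using regular[OF assms(2)] \<open>\<delta> v w = d\<close> d_ge by simp
  qed
qed

lemma sum_vertex_edge:
  assumes "v \<in> V"
  shows "(\<Sum>e\<in>edges E. real (1 + 2 * Min (\<delta> v ` e))) = k * S2' k d"
proof -
  obtain m where m: "d = Suc m" using d_ge by (cases d) auto
  let ?g = "\<lambda>i. if i = 0 then real k else if i < d then 2 * real i - 1 + q * (2 * real i + 1)
      else k * (2 * real i - 1)"
  \<comment> \<open>Each edge is counted from both ends. Counted from the farther ends, the edges
    give \<open>?S\<close> plus the top-level term; counted from the nearer ends, they give the term
    of \<open>v\<close> plus \<open>?T\<close>. Up to the factor \<open>k\<close>, both totals are
    \<open>S2' k d\<close>.\<close>
  let ?S = "\<Sum>i<m. (2 * real i + 1) * q ^ i" and ?T = "\<Sum>i<m. (2 * real i + 3) * q ^ Suc i"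
  have S: "S2' k d = ?S + (2 * real m + 1) * q ^ m"
    using S2'_eq_sum[OF k_ge, of d] m by simp
  have T: "S2' k d = 1 + ?T"
    using S2'_eq_sum[OF k_ge, of d] unfolding m sum.lessThan_Suc_shift
    by (simp add: algebra_simps)
  have "2 * (\<Sum>e\<in>edges E. real (1 + 2 * Min (\<delta> v ` e))) =
      (\<Sum>w\<in>V. \<Sum>x\<in>E `` {w}. real (1 + 2 * min (\<delta> v w) (\<delta> v x)))"
    unfolding sum_edges by (simp add: min_def)
  also have "\<dots> = (\<Sum>w\<in>V. ?g (\<delta> v w))"
    using sum_nbrs_vertex[OF assms] by (intro sum.cong) (auto simp: Let_def)
  also have "\<dots> = ?g 0 + (\<Sum>i<d - 1. k * q ^ i * ?g (Suc i)) + q ^ (d - 1) * ?g d"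
    using assms by (rule sum_dist_vertex)
  also have "(\<Sum>i<d - 1. k * q ^ i * ?g (Suc i)) =
      (\<Sum>i<m. k * ((2 * real i + 1) * q ^ i) + k * ((2 * real i + 3) * q ^ Suc i))"
    using m by (intro sum.cong) (auto simp: algebra_simps)
  also have "\<dots> = k * ?S + k * ?T"
    by (simp only: sum.distrib sum_distrib_left)
  also have "?g 0 + (k * ?S + k * ?T) + q ^ (d - 1) * ?g d =
      k * (?S + (2 * real m + 1) * q ^ m) + k * (1 + ?T)"
    by (simp add: m algebra_simps)
  also have "\<dots> = 2 * (k * S2' k d)"
    using S T by simp
  finally show ?thesis by simp
qed

lemma sum_edge_vertex:
  assumes "(a, b) \<in> E"
  shows "(\<Sum>w\<in>V. real (1 + 2 * edist a b w)) = 2 * S2' k d"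
  using sum_edist[OF assms, of "\<lambda>i. real (1 + 2 * i)"] S2'_eq_sum[OF k_ge, of d]
  by (simp add: sum_distrib_left algebra_simps)

text \<open>The edge \<open>{a, b}\<close> is treated like any other here and gets 2 instead of 0,
  to be corrected in \<open>sum_edge_edge\<close>. Because of \<open>min\<close>, neighbours on the
  level of \<open>w\<close>, which occur for \<open>edist a b w = d - 1\<close>, count like those
  one level up.\<close>

lemma sum_nbrs_edge:
  assumes "(a, b) \<in> E" "w \<in> V"
  shows "(\<Sum>x\<in>E `` {w}. real (2 + 2 * min (edist a b w) (edist a b x))) =
    (let i = edist a b w in if i = 0 then 2 * real k else 2 * real i + q * (2 * real i + 2))"
proof (cases "edist a b w")
  case 0
  then show ?thesis using regular[OF assms(2)] by simp
next
  case (Suc j)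
  have "(\<Sum>x\<in>E `` {w}. real (2 + 2 * min (edist a b w) (edist a b x))) =
      2 * real (Suc j) + q * (2 * real (Suc j) + 2)"
  proof (rule sum_nbrs_one_exception[where P = "\<lambda>x. edist a b x = j"])
    show "w \<in> V" by fact
    show "card {x. (w, x) \<in> E \<and> edist a b x = j} = 1"
      using card_edist_down[OF assms Suc] .
  next
    fix x assume "(w, x) \<in> E" "edist a b x = j"
    then show "real (2 + 2 * min (edist a b w) (edist a b x)) = 2 * real (Suc j)" using Suc by simp
  next
    fix x assume x: "(w, x) \<in> E" "edist a b x \<noteq> j"
    then have "edist a b x \<ge> Suc j"
      using edist_step[OF assms(1) E_sym[OF x(1)]] Suc by simp
    then show "real (2 + 2 * min (edist a b w) (edist a b x)) = 2 * real (Suc j) + 2"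
      using Suc by simp
  qed
  then show ?thesis using Suc by (simp add: Let_def)
qed

lemma finite_edges: "finite (edges E)"
proof -
  have "edges E \<subseteq> Pow V" using E_in by (auto simp: edges_def)
  then show ?thesis using finite_V finite_subset by blast
qed

lemma sum_edge_edge:
  assumes "(a, b) \<in> E"
  shows "(\<Sum>f\<in>edges E. real (if f = {a, b} then 0 else 2 + 2 * Min (edist a b ` f))) =
    4 * q * S1' k d + 2 * d * q ^ d"
proof -
  obtain m where m: "d = Suc m" using d_ge by (cases d) auto
  let ?h = "\<lambda>f. real (2 + 2 * Min (edist a b ` f))"
  let ?g = "\<lambda>i. if i = 0 then 2 * real k else 2 * real i + q * (2 * real i + 2)"
  have ab: "{a, b} \<in> edges E" "?h {a, b} = 2"
    using assms by (auto simp: edges_def edist_def)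
  have "(\<Sum>f\<in>edges E. real (if f = {a, b} then 0 else 2 + 2 * Min (edist a b ` f))) =
      (\<Sum>f\<in>edges E - {{a, b}}. ?h f)"
    using ab finite_edges by (subst sum.remove[of _ "{a, b}"]) (auto intro!: sum.cong)
  also have "\<dots> = (\<Sum>f\<in>edges E. ?h f) - 2"
    using ab finite_edges by (subst sum.remove[of "edges E" "{a, b}"]) auto
  finally have less2: "(\<Sum>f\<in>edges E. real (if f = {a, b} then 0 else 2 + 2 * Min (edist a b ` f))) =
      (\<Sum>f\<in>edges E. ?h f) - 2" .
  have S: "S1' k d = (\<Sum>i<m. real (Suc i) * q ^ i)"
    using S1'_eq_sum[OF k_ge, of m] m by simp
  \<comment> \<open>One more term extends the sum for \<open>S1'\<close> to length \<open>d\<close>;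
    splitting off its first term then shifts the index.\<close>
  have T: "S1' k d + real d * q ^ m = 1 + (\<Sum>i<m. (real i + 2) * q ^ Suc i)"
  proof -
    have "S1' k d + real d * q ^ m = (\<Sum>i<Suc m. real (Suc i) * q ^ i)"
      using S m by simp
    then show ?thesis
      unfolding sum.lessThan_Suc_shift by (simp add: algebra_simps)
  qed
  have "2 * (\<Sum>f\<in>edges E. ?h f) =
      (\<Sum>w\<in>V. \<Sum>x\<in>E `` {w}. real (2 + 2 * min (edist a b w) (edist a b x)))"
    unfolding sum_edges by (simp add: min_def)
  also have "\<dots> = (\<Sum>w\<in>V. ?g (edist a b w))"
    using sum_nbrs_edge[OF assms] by (intro sum.cong) (auto simp: Let_def)
  also have "\<dots> = (\<Sum>i<d. 2 * q ^ i * ?g i)"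
    using assms by (rule sum_edist)
  also have "\<dots> = 4 * k + (\<Sum>i<m. 2 * q ^ Suc i * ?g (Suc i))"
    unfolding m sum.lessThan_Suc_shift by simp
  also have "(\<Sum>i<m. 2 * q ^ Suc i * ?g (Suc i)) =
      (\<Sum>i<m. (4 * q) * (real (Suc i) * q ^ i) + (4 * q) * ((real i + 2) * q ^ Suc i))"
    by (intro sum.cong) (auto simp: algebra_simps)
  \<comment> \<open>In the doubled sum, the correction for \<open>{a, b}\<close> is 4, and the
    constants cancel: \<open>4 * k - 4 * q - 4 = 0\<close>.\<close>
  also have "\<dots> = 4 * q * S1' k d + 4 * q * (S1' k d + real d * q ^ m - 1)"
    unfolding S[symmetric] T sum.distrib sum_distrib_left[symmetric] by simp
  finally show ?thesis
    unfolding less2 by (simp add: m algebra_simps)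
qed

end

section \<open>The distance matrix of the subdivision graph\<close>

lemma edge_set_eq_edges: "edge_set G = edges (parcs G)"
  by (simp add: edge_set_def edges_def)

context even_moore
begin

definition sub_arcs :: "(('a + 'a set) \<times> ('a + 'a set)) set" where
  "sub_arcs = {(Inl v, Inr e) | v e. e \<in> edges E \<and> v \<in> e} \<union>
              {(Inr e, Inl v) | v e. e \<in> edges E \<and> v \<in> e}"

definition sub_verts :: "('a + 'a set) set" where
  "sub_verts = Inl ` V \<union> Inr ` edges E"

lemma edge_in_V: "e \<in> edges E \<Longrightarrow> w \<in> e \<Longrightarrow> w \<in> V"
  using E_in by (auto simp: edges_def)

lemma edge_finite: "e \<in> edges E \<Longrightarrow> finite e" "e \<in> edges E \<Longrightarrow> e \<noteq> {}"
  by (auto simp: edges_def)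

lemma edge_Min_attained:
  fixes g :: "'a \<Rightarrow> nat"
  assumes "e \<in> edges E"
  obtains u where "u \<in> e" "Min (g ` e) = g u"
proof -
  have "Min (g ` e) \<in> g ` e" using edge_finite[OF assms] by (intro Min_in) auto
  then show ?thesis using that by blast
qed

lemma edge_Min_le:
  fixes g :: "'a \<Rightarrow> nat"
  shows "e \<in> edges E \<Longrightarrow> w \<in> e \<Longrightarrow> Min (g ` e) \<le> g w"
  by (intro Min_le finite_imageI imageI edge_finite)

lemma edge_Min_ge:
  fixes g :: "'a \<Rightarrow> nat"
  assumes "e \<in> edges E" "w \<in> e" "\<And>x y. (x, y) \<in> E \<Longrightarrow> g y \<le> Suc (g x)"
  shows "g w \<le> Suc (Min (g ` e))"
proof -
  obtain u where u: "u \<in> e" "Min (g ` e) = g u" using edge_Min_attained[OF assms(1)] by blast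
  have "u = w \<or> (u, w) \<in> E" using assms(1,2) u(1) E_sym by (auto simp: edges_def)
  then show ?thesis using u assms(3) by auto
qed

text \<open>Every arc is doubled in length, and a new vertex is entered through its nearer end.
  Predecessors are the new vertex on the last edge of a geodesic, or the nearer end of the
  edge.\<close>

lemma rdist_sub_Inl:
  assumes "v \<in> V" "z \<in> sub_verts"
  shows "rdist sub_arcs (Inl v) z = case_sum (\<lambda>w. 2 * \<delta> v w) (\<lambda>e. 1 + 2 * Min (\<delta> v ` e)) z"
    (is "_ = ?f z")
proof (rule rdist_eqI[OF assms(2)])
  show "?f (Inl v) = 0" by simp
next
  fix x y assume "(x, y) \<in> sub_arcs"
  then consider w e where "x = Inl w" "y = Inr e" "e \<in> edges E" "w \<in> e"
    | w e where "x = Inr e" "y = Inl w" "e \<in> edges E" "w \<in> e"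
    by (auto simp: sub_arcs_def)
  then show "?f y \<le> Suc (?f x)"
  proof cases
    case 1
    then show ?thesis using edge_Min_le[of e w "\<delta> v"] by simp
  next
    case 2
    then show ?thesis using edge_Min_ge[of e w "\<delta> v"] dist_step[OF assms(1)] by simp
  qed
next
  fix y assume "y \<in> sub_verts" "?f y = 0"
  then show "y = Inl v" using dist_eq_0_iff assms by (auto simp: sub_verts_def)
next
  fix y m assume y: "y \<in> sub_verts" "?f y = Suc m"
  then consider w where "y = Inl w" "w \<in> V" | e where "y = Inr e" "e \<in> edges E"
    by (auto simp: sub_verts_def)
  then show "\<exists>x\<in>sub_verts. (x, y) \<in> sub_arcs \<and> ?f x = m"
  proof cases
    case 1
    then obtain j where j: "\<delta> v w = Suc j" using y by (cases "\<delta> v w") auto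
    then obtain x where x: "(x, w) \<in> E" "\<delta> v x = j"
      using dist_pred[OF assms(1) \<open>w \<in> V\<close>] by metis
    have "{x, w} \<in> edges E" using x by (auto simp: edges_def)
    then show ?thesis
      using x j y 1 by (intro bexI[of _ "Inr {x, w}"]) (auto simp: sub_arcs_def sub_verts_def)
  next
    case 2
    obtain u where "u \<in> e" "Min (\<delta> v ` e) = \<delta> v u"
      using edge_Min_attained[OF 2(2)] by blast
    then show ?thesis
      using 2 y edge_in_V by (intro bexI[of _ "Inl u"]) (auto simp: sub_arcs_def sub_verts_def)
  qed
qed

lemma rdist_sub_Inr:
  assumes ab: "(a, b) \<in> E" and z: "z \<in> sub_verts"
  shows "rdist sub_arcs (Inr {a, b}) z =
    case_sum (\<lambda>w. 1 + 2 * edist a b w)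
      (\<lambda>f. if f = {a, b} then 0 else 2 + 2 * Min (edist a b ` f)) z"
    (is "_ = ?f z")
proof (rule rdist_eqI[OF z])
  show "?f (Inr {a, b}) = 0" by simp
next
  fix x y assume "(x, y) \<in> sub_arcs"
  then consider w e where "x = Inl w" "y = Inr e" "e \<in> edges E" "w \<in> e"
    | w e where "x = Inr e" "y = Inl w" "e \<in> edges E" "w \<in> e"
    by (auto simp: sub_arcs_def)
  then show "?f y \<le> Suc (?f x)"
  proof cases
    case 1
    then show ?thesis using edge_Min_le[of e w "edist a b"] by simp
  next
    case 2
    \<comment> \<open>The exceptional value 0 at \<open>{a, b}\<close> is harmless: its ends have
      \<open>edist\<close> 0 and hence value 1.\<close>
    then show ?thesis
      using edge_Min_ge[of e w "edist a b"] edist_step[OF ab] edist_eq_0_iff[OF ab, of w] edge_in_V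
      by auto
  qed
next
  fix y assume "y \<in> sub_verts" "?f y = 0"
  then show "y = Inr {a, b}" by (auto simp: sub_verts_def split: if_splits)
next
  fix y m assume y: "y \<in> sub_verts" "?f y = Suc m"
  then consider w where "y = Inl w" "w \<in> V" | e where "y = Inr e" "e \<in> edges E" "e \<noteq> {a, b}"
    by (auto simp: sub_verts_def split: if_splits)
  then show "\<exists>x\<in>sub_verts. (x, y) \<in> sub_arcs \<and> ?f x = m"
  proof cases
    case 1
    show ?thesis
    proof (cases "edist a b w")
      case 0
      then have "w \<in> {a, b}" using edist_eq_0_iff[OF ab] 1 by blast
      moreover have "{a, b} \<in> edges E" using ab by (auto simp: edges_def)
      ultimately show ?thesis
        using 0 y 1 by (intro bexI[of _ "Inr {a, b}"]) (auto simp: sub_arcs_def sub_verts_def)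
    next
      case (Suc j)
      obtain x where "{x. (w, x) \<in> E \<and> edist a b x = j} = {x}"
        using card_edist_down[OF ab 1(2) Suc] by (rule card_1_singletonE)
      then have x: "(w, x) \<in> E" "edist a b x = j" by blast+
      have "{x, w} \<in> edges E" using x E_sym by (auto simp: edges_def)
      \<comment> \<open>The last edge before \<open>w\<close> must differ from
        \<open>{a, b}\<close>, so that the general formula and not the exceptional 0 applies to
        it.\<close>
      moreover have "w \<notin> {a, b}" using edist_eq_0_iff[OF ab 1(2)] Suc by simp
      then have "{x, w} \<noteq> {a, b}" by blast
      ultimately show ?thesis
        using x Suc y 1 by (intro bexI[of _ "Inr {x, w}"]) (auto simp: sub_arcs_def sub_verts_def)
    qed
  next
    case 2
    obtain u where "u \<in> e" "Min (edist a b ` e) = edist a b u"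
      using edge_Min_attained[OF 2(2)] by blast
    then show ?thesis
      using 2 y edge_in_V by (intro bexI[of _ "Inl u"]) (auto simp: sub_arcs_def sub_verts_def)
  qed
qed

lemma sum_sub_verts:
  fixes h :: "'a + 'a set \<Rightarrow> real"
  shows "(\<Sum>z\<in>sub_verts. h z) = (\<Sum>w\<in>V. h (Inl w)) + (\<Sum>e\<in>edges E. h (Inr e))"
proof -
  have "(\<Sum>z\<in>sub_verts. h z) = (\<Sum>z\<in>Inl ` V. h z) + (\<Sum>z\<in>Inr ` edges E. h z)"
    unfolding sub_verts_def using finite_V finite_edges by (intro sum.union_disjoint) auto
  then show ?thesis by (simp add: sum.reindex)
qed

text \<open>The distance matrix applied to a vector constant on old and on new vertices: the
  coefficients are the first row of the quotient matrix, and \<open>row_sum_Inr\<close> gives the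
  second.\<close>

lemma row_sum_Inl:
  fixes \<alpha> \<beta> :: real
  assumes "v \<in> V"
  shows "(\<Sum>z\<in>sub_verts. real (rdist sub_arcs (Inl v) z) * case_sum (\<lambda>_. \<alpha>) (\<lambda>_. \<beta>) z) =
    (2 * k * S1' k d + 2 * d * q ^ (d - 1)) * \<alpha> + k * S2' k d * \<beta>"
proof -
  have "(\<Sum>z\<in>sub_verts. real (rdist sub_arcs (Inl v) z) * case_sum (\<lambda>_. \<alpha>) (\<lambda>_. \<beta>) z) =
      (\<Sum>z\<in>sub_verts. real (case_sum (\<lambda>w. 2 * \<delta> v w) (\<lambda>e. 1 + 2 * Min (\<delta> v ` e)) z)
        * case_sum (\<lambda>_. \<alpha>) (\<lambda>_. \<beta>) z)"
    using rdist_sub_Inl[OF assms] by (intro sum.cong) simp_all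
  also have "\<dots> = (\<Sum>w\<in>V. real (2 * \<delta> v w)) * \<alpha> + (\<Sum>e\<in>edges E. real (1 + 2 * Min (\<delta> v ` e))) * \<beta>"
    unfolding sum_sub_verts sum_distrib_right by simp
  finally show ?thesis
    unfolding sum_vertex_vertex[OF assms] sum_vertex_edge[OF assms] .
qed

lemma row_sum_Inr:
  fixes \<alpha> \<beta> :: real
  assumes "e \<in> edges E"
  shows "(\<Sum>z\<in>sub_verts. real (rdist sub_arcs (Inr e) z) * case_sum (\<lambda>_. \<alpha>) (\<lambda>_. \<beta>) z) =
    2 * S2' k d * \<alpha> + (4 * q * S1' k d + 2 * d * q ^ d) * \<beta>"
proof -
  obtain a b where e: "e = {a, b}" "(a, b) \<in> E" using assms by (auto simp: edges_def)
  let ?f = "\<lambda>f. if f = {a, b} then 0 else 2 + 2 * Min (edist a b ` f)"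
  have "(\<Sum>z\<in>sub_verts. real (rdist sub_arcs (Inr e) z) * case_sum (\<lambda>_. \<alpha>) (\<lambda>_. \<beta>) z) =
      (\<Sum>z\<in>sub_verts. real (case_sum (\<lambda>w. 1 + 2 * edist a b w) ?f z)
        * case_sum (\<lambda>_. \<alpha>) (\<lambda>_. \<beta>) z)"
    using rdist_sub_Inr[OF e(2)] e(1) by (intro sum.cong) simp_all
  also have "\<dots> = (\<Sum>w\<in>V. real (1 + 2 * edist a b w)) * \<alpha> + (\<Sum>f\<in>edges E. real (?f f)) * \<beta>"
    unfolding sum_sub_verts sum_distrib_right by simp
  finally show ?thesis
    unfolding sum_edge_vertex[OF e(2)] sum_edge_edge[OF e(2)] .
qed

lemma S2'_pos: "S2' k d > 0"
proof -
  have "q > 0" using k_ge by simp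
  then show ?thesis
    unfolding S2'_eq_sum[OF k_ge] using d_ge
    by (intro sum_pos mult_pos_pos zero_less_power) (auto simp: lessThan_empty_iff)
qed

end

section \<open>The largest eigenvalue from a positive eigenvector\<close>

lemma Max_spectrum_eq_Perron:
  fixes A :: "real mat" and x :: "nat \<Rightarrow> real"
  assumes A: "A \<in> carrier_mat n n" and "n > 0"
    and nonneg: "\<And>i j. i < n \<Longrightarrow> j < n \<Longrightarrow> A $$ (i, j) \<ge> 0"
    and sym: "\<And>i j. i < n \<Longrightarrow> j < n \<Longrightarrow> A $$ (i, j) = A $$ (j, i)"
    and pos: "\<And>i. i < n \<Longrightarrow> x i > 0"
    and eig: "\<And>i. i < n \<Longrightarrow> (\<Sum>j<n. A $$ (i, j) * x j) = r * x i"
  shows "Max (spectrum A) = r"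
proof (rule Max_eqI)
  show "finite (spectrum A)" using A by (rule card_finite_spectrum)
next
  have mult: "(A *\<^sub>v y) $ i = (\<Sum>j<n. A $$ (i, j) * y $ j)" if "i < n" "y \<in> carrier_vec n" for y i
    using that A by (simp add: scalar_prod_def atLeast0LessThan)
  have "eigenvector A (vec n x) r"
    unfolding eigenvector_def
  proof (intro conjI)
    show "vec n x \<in> carrier_vec (dim_row A)" using A by simp
    show "vec n x \<noteq> 0\<^sub>v (dim_row A)"
    proof
      assume "vec n x = 0\<^sub>v (dim_row A)"
      then have "vec n x $ 0 = 0" using A \<open>n > 0\<close> by simp
      then show False using pos[of 0] \<open>n > 0\<close> by simp
    qed
    show "A *\<^sub>v vec n x = r \<cdot>\<^sub>v vec n x"
      using A eig mult by (intro eq_vecI) (simp_all del: index_mult_mat_vec)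
  qed
  then show "r \<in> spectrum A" by (auto simp: spectrum_def eigenvalue_def)
next
  fix s assume "s \<in> spectrum A"
  then obtain y where y: "y \<in> carrier_vec n" "y \<noteq> 0\<^sub>v n" "A *\<^sub>v y = s \<cdot>\<^sub>v y"
    using A by (auto simp: spectrum_def eigenvalue_def eigenvector_def)
  have row: "s * y $ i = (\<Sum>j<n. A $$ (i, j) * y $ j)" if "i < n" for i
  proof -
    have "(A *\<^sub>v y) $ i = s * y $ i" using y that by simp
    then show ?thesis using that A y(1) by (simp add: scalar_prod_def atLeast0LessThan)
  qed
  \<comment> \<open>Pairing \<open>\<bar>y\<bar>\<close> with \<open>x\<close>: the triangle
    inequality gives \<open>s * \<bar>y\<bar> \<le> A \<bar>y\<bar>\<close> entrywise, and symmetry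
    moves \<open>A\<close> onto \<open>x\<close>, where it acts as \<open>r\<close>. Positivity of
    \<open>?p\<close> then allows cancelling it.\<close>
  let ?p = "\<Sum>i<n. x i * \<bar>y $ i\<bar>"
  have "s * ?p \<le> (\<Sum>i<n. x i * \<bar>s * y $ i\<bar>)"
    unfolding sum_distrib_left
  proof (rule sum_mono)
    fix i assume "i \<in> {..<n}"
    then have "x i * (s * \<bar>y $ i\<bar>) \<le> x i * \<bar>s * y $ i\<bar>"
      using pos[of i] by (intro mult_left_mono) (auto simp: abs_mult intro: mult_right_mono)
    then show "s * (x i * \<bar>y $ i\<bar>) \<le> x i * \<bar>s * y $ i\<bar>" by (simp add: mult_ac)
  qed
  also have "\<dots> \<le> (\<Sum>i<n. x i * (\<Sum>j<n. A $$ (i, j) * \<bar>y $ j\<bar>))"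
  proof (intro sum_mono mult_left_mono)
    fix i assume i: "i \<in> {..<n}"
    have "\<bar>\<Sum>j<n. A $$ (i, j) * y $ j\<bar> \<le> (\<Sum>j<n. \<bar>A $$ (i, j) * y $ j\<bar>)" by (rule sum_abs)
    then show "\<bar>s * y $ i\<bar> \<le> (\<Sum>j<n. A $$ (i, j) * \<bar>y $ j\<bar>)"
      using i row nonneg by (simp add: abs_mult)
    show "0 \<le> x i" using pos i by (simp add: less_imp_le)
  qed
  also have "\<dots> = (\<Sum>j<n. \<Sum>i<n. x i * (A $$ (i, j) * \<bar>y $ j\<bar>))"
    unfolding sum_distrib_left by (rule sum.swap)
  also have "\<dots> = (\<Sum>j<n. (\<Sum>i<n. A $$ (j, i) * x i) * \<bar>y $ j\<bar>)"
    unfolding sum_distrib_right using sym by (intro sum.cong refl) (auto simp: mult_ac)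
  also have "\<dots> = r * ?p"
    unfolding sum_distrib_left using eig by (intro sum.cong) (auto simp: mult_ac)
  finally have "s * ?p \<le> r * ?p" .
  moreover have "?p > 0"
  proof -
    have "\<exists>i<n. y $ i \<noteq> 0"
    proof (rule ccontr)
      assume "\<not> (\<exists>i<n. y $ i \<noteq> 0)"
      then have "y = 0\<^sub>v n" using y(1) by (intro eq_vecI) auto
      then show False using y(2) by simp
    qed
    then obtain i where i: "i < n" "y $ i \<noteq> 0" by blast
    show ?thesis
      using pos i by (intro sum_pos2[of _ i]) (auto simp: less_imp_le)
  qed
  ultimately show "s \<le> r" by simp
qed

lemma distance_spectral_radius_eqI:
  fixes H :: "'b pair_pre_digraph" and x :: "'b \<Rightarrow> real"
  assumes "pair_wf_digraph H" "sym (parcs H)" "distinct us" "set us = pverts H" "us \<noteq> []"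
    and pos: "\<And>u. u \<in> pverts H \<Longrightarrow> x u > 0"
    and eig: "\<And>u. u \<in> pverts H \<Longrightarrow> (\<Sum>z\<in>pverts H. real (rdist (parcs H) u z) * x z) = r * x u"
  shows "distance_spectral_radius H us = r"
proof -
  interpret pair_wf_digraph H by fact
  have us: "us ! i \<in> pverts H" if "i < length us" for i
    using that assms(4) by force
  show ?thesis
    unfolding distance_spectral_radius_def
  proof (rule Max_spectrum_eq_Perron[where n = "length us" and x = "\<lambda>i. x (us ! i)"])
    fix i assume i: "i < length us"
    have "(\<Sum>j<length us. distance_matrix H us $$ (i, j) * x (us ! j)) =
        (\<Sum>j<length us. real (rdist (parcs H) (us ! i) (us ! j)) * x (us ! j))"
      using i us by (intro sum.cong) (auto simp: distance_matrix_def graph_dist_eq_rdist)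
    also have "\<dots> = (\<Sum>z\<in>pverts H. real (rdist (parcs H) (us ! i) z) * x z)"
      using assms(3,4) by (intro sum.reindex_bij_betw[OF bij_betw_nth]) auto
    finally show "(\<Sum>j<length us. distance_matrix H us $$ (i, j) * x (us ! j)) = r * x (us ! i)"
      using eig[OF us[OF i]] by simp
  next
    fix i j assume "i < length us" "j < length us"
    then show "distance_matrix H us $$ (i, j) = distance_matrix H us $$ (j, i)"
      using us rdist_sym[OF assms(2)] by (simp add: distance_matrix_def graph_dist_eq_rdist)
  qed (use assms us in \<open>auto simp: distance_matrix_def\<close>)
qed

text \<open>For the matrix \<open>[[a, b], [c, e]]\<close> the vector \<open>(b, r - a)\<close>
  satisfies the first row for every \<open>r\<close>; the second row is the characteristic equation.
  As \<open>b * c > 0\<close>, the root exceeds \<open>\<bar>a - e\<bar> / 2\<close>, which makes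
  \<open>r - a\<close> positive.\<close>

lemma larger_root_eigenvector:
  fixes a b c e r :: real
  assumes "b > 0" "c > 0" and r: "r = (a + e) / 2 + sqrt (((a - e) / 2)\<^sup>2 + b * c)"
  shows "r - a > 0" "a * b + b * (r - a) = r * b" "c * b + e * (r - a) = r * (r - a)"
proof -
  define s where "s = sqrt (((a - e) / 2)\<^sup>2 + b * c)"
  have bc: "b * c > 0" using assms by simp
  have rs: "r = (a + e) / 2 + s" using r by (simp add: s_def)
  have "sqrt (((a - e) / 2)\<^sup>2) < s"
    unfolding s_def using bc by (subst real_sqrt_less_iff) simp
  then have "\<bar>(a - e) / 2\<bar> < s" by (simp only: real_sqrt_abs)
  then show "r - a > 0" unfolding rs by (simp add: field_simps)
  show "a * b + b * (r - a) = r * b" by (simp add: algebra_simps)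
  have "s\<^sup>2 = ((a - e) / 2)\<^sup>2 + b * c"
    unfolding s_def using bc by (intro real_sqrt_pow2) simp
  then have "(r - (a + e) / 2)\<^sup>2 = ((a - e) / 2)\<^sup>2 + b * c"
    unfolding rs by simp
  then show "c * b + e * (r - a) = r * (r - a)"
    by (simp add: power2_eq_square field_simps)
qed

theorem (in even_moore) distance_spectral_radius_subdivision:
  assumes "pverts G = V" "parcs G = E" "distinct vs" "set vs = pverts (subdivision_graph G)"
  shows "distance_spectral_radius (subdivision_graph G) vs =
    (3 * real k - 2) * S1' k d + real d * real k * (real k - 1) ^ (d - 1) +
    sqrt ((real k - 2)\<^sup>2 * (S1' k d)\<^sup>2 + 2 * real k * (S2' k d)\<^sup>2
      + 2 * real d * (real k - 2)\<^sup>2 * (real k - 1) ^ (d - 1) * S1' k d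
      + (real d)\<^sup>2 * (real k - 2)\<^sup>2 * (real k - 1) ^ (2 * d - 2))"
    (is "_ = ?r")
proof -
  have H: "pverts (subdivision_graph G) = sub_verts" "parcs (subdivision_graph G) = sub_arcs"
    using assms by (simp_all add: subdivision_graph_def sub_verts_def sub_arcs_def edge_set_eq_edges)
  obtain m where m: "d = Suc m" using d_ge by (cases d) auto
  define a where "a = 2 * k * S1' k d + 2 * d * q ^ (d - 1)"
  define b where "b = k * S2' k d"
  define c where "c = 2 * S2' k d"
  define e where "e = 4 * q * S1' k d + 2 * d * q ^ d"
  have half_sum: "(a + e) / 2 = (3 * real k - 2) * S1' k d + real d * real k * q ^ (d - 1)"
    unfolding a_def e_def m by (simp add: field_simps)
  \<comment> \<open>Both parts of \<open>a - e\<close> share the factor \<open>k - 2\<close>, since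
    \<open>2 * k - 4 * q = - 2 * (k - 2)\<close> and \<open>1 - q = - (k - 2)\<close>. Squaring
    yields the three terms with \<open>(k - 2)\<^sup>2\<close> under the root.\<close>
  have half_diff: "(a - e) / 2 = - (real k - 2) * (S1' k d + real d * q ^ (d - 1))"
    unfolding a_def e_def m by (simp add: field_simps)
  have "q ^ (2 * d - 2) = (q ^ (d - 1))\<^sup>2"
    using m by (simp add: power_mult[symmetric] mult.commute)
  then have "((a - e) / 2)\<^sup>2 + b * c = (real k - 2)\<^sup>2 * (S1' k d)\<^sup>2 + 2 * real k * (S2' k d)\<^sup>2
      + 2 * real d * (real k - 2)\<^sup>2 * q ^ (d - 1) * S1' k d
      + (real d)\<^sup>2 * (real k - 2)\<^sup>2 * q ^ (2 * d - 2)"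
    unfolding half_diff b_def c_def by (simp add: power2_eq_square algebra_simps)
  then have r: "?r = (a + e) / 2 + sqrt (((a - e) / 2)\<^sup>2 + b * c)"
    unfolding half_sum by simp
  have bc: "b > 0" "c > 0" using S2'_pos k_ge by (simp_all add: b_def c_def)
  note root = larger_root_eigenvector[OF bc r]
  show ?thesis
  proof (rule distance_spectral_radius_eqI[where x = "case_sum (\<lambda>_. b) (\<lambda>_. ?r - a)"])
    show "pair_wf_digraph (subdivision_graph G)"
      by unfold_locales (auto simp: H sub_arcs_def sub_verts_def dest: edge_in_V)
    show "sym (parcs (subdivision_graph G))"
      by (auto simp: H sub_arcs_def sym_def)
    show "distinct vs" "set vs = pverts (subdivision_graph G)" by fact+
    show "vs \<noteq> []" using assms(4) V_ne by (auto simp: H sub_verts_def)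
  next
    fix u assume "u \<in> pverts (subdivision_graph G)"
    then show "case_sum (\<lambda>_. b) (\<lambda>_. ?r - a) u > 0"
      using bc root(1) by (auto split: sum.split)
  next
    fix u assume "u \<in> pverts (subdivision_graph G)"
    then consider v where "u = Inl v" "v \<in> V" | f where "u = Inr f" "f \<in> edges E"
      unfolding H sub_verts_def by blast
    then show "(\<Sum>z\<in>pverts (subdivision_graph G). real (rdist (parcs (subdivision_graph G)) u z)
        * case_sum (\<lambda>_. b) (\<lambda>_. ?r - a) z) = ?r * case_sum (\<lambda>_. b) (\<lambda>_. ?r - a) u"
    proof cases
      case 1
      show ?thesis
        using row_sum_Inl[OF 1(2), of b "?r - a"] root(2)
        unfolding H 1(1) a_def[symmetric] b_def[symmetric] by simp
    next
      case 2
      show ?thesis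
        using row_sum_Inr[OF 2(2), of b "?r - a"] root(3)
        unfolding H 2(1) c_def[symmetric] e_def[symmetric] by simp
    qed
  qed
qed

section \<open>From minimal cages to the counting setting\<close>

lemma even_mooreI:
  assumes "k \<ge> 3" "even g" "minimal_cage k g G"
  shows "even_moore (pverts G) (parcs G) k (g div 2)"
proof -
  have conn: "connected_graph G" and reg: "regular_graph k G" and gir: "girth G = enat g"
    and card: "card (pverts G) = moore_bound k g"
    using assms(3) by (auto simp: minimal_cage_def cage_def regular_girth_graph_def)
  interpret pair_graph G using conn by (simp add: connected_graph_def)
  have "strongly_connected (with_proj G)"
    using conn symmetric_connected_imp_strongly_connected[OF pair_sym_arcs]
    by (simp add: connected_graph_def)
  then have ne: "pverts G \<noteq> {}"
    and reach: "\<And>u v. u \<in> pverts G \<Longrightarrow> v \<in> pverts G \<Longrightarrow> u \<rightarrow>\<^sup>*\<^bsub>with_proj G\<^esub> v"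
    by (auto simp: strongly_connected_def)
  \<comment> \<open>Only cycles of length at least 3 count for the girth, so an even
    \<open>g\<close> is at least 4 and \<open>g div 2 \<ge> 2\<close>.\<close>
  have "girth G \<ge> enat 3"
    unfolding girth_def by (intro INF_greatest) auto
  then have "g \<ge> 3" using gir by simp
  then have d: "g div 2 \<ge> 2" "2 * (g div 2) = g" using assms(2) by auto
  show ?thesis
  proof
    show "finite (pverts G)" by (rule pair_finite_verts)
    show "pverts G \<noteq> {}" by fact
    show "parcs G \<subseteq> pverts G \<times> pverts G" using wellformed' by auto
    show "sym (parcs G)" using arcs_symmetric by (auto simp: sym_def)
    show "(x, x) \<notin> parcs G" for x using no_loops'[of x x] by blast
    show "(u, v) \<in> (parcs G)\<^sup>*" if "u \<in> pverts G" "v \<in> pverts G" for u v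
      using reach[OF that] by (auto simp: reachable_def elim: rtrancl_on_rtranclI)
    show "3 \<le> k" "2 \<le> g div 2" by fact+
    show "card (parcs G `` {v}) = k" if "v \<in> pverts G" for v
    proof -
      have "out_arcs (with_proj G) v = Pair v ` (parcs G `` {v})"
        by (auto simp: out_arcs_def)
      then have "out_degree (with_proj G) v = card (parcs G `` {v})"
        by (simp add: out_degree_def card_image inj_on_def)
      then show ?thesis using reg that by (simp add: regular_graph_def)
    qed
    show "2 * (g div 2) \<le> n + 2"
      if "(w, x) \<in> parcs G" "(w, y) \<in> parcs G" "x \<noteq> y"
        "(x, y) \<in> (parcs G \<inter> (- {w}) \<times> (- {w})) ^^ n" for w x y n
      using girth_le[OF that] gir d by simp
    show "card (pverts G) = 1 + (\<Sum>i<g div 2 - 1. k * (k - 1) ^ i) + (k - 1) ^ (g div 2 - 1)"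
      using card assms(2) by (simp add: moore_bound_def Let_def)
  qed
qed

theorem theorem3p2:
  fixes k g d :: nat and G :: "'a pair_pre_digraph" and vs :: "('a + 'a set) list"
  assumes "k \<ge> 3" and "even g"
    and "minimal_cage k g G" and "graph_diameter G = d"
    and "distinct vs" and "set vs = pverts (subdivision_graph G)"
  shows "distance_spectral_radius (subdivision_graph G) vs =
    (3 * real k - 2) * S1' k d + real d * real k * (real k - 1) ^ (d - 1) +
    sqrt ((real k - 2)\<^sup>2 * (S1' k d)\<^sup>2 + 2 * real k * (S2' k d)\<^sup>2
      + 2 * real d * (real k - 2)\<^sup>2 * (real k - 1) ^ (d - 1) * S1' k d
      + (real d)\<^sup>2 * (real k - 2)\<^sup>2 * (real k - 1) ^ (2 * d - 2))"
proof -
  interpret even_moore "pverts G" "parcs G" k "g div 2"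
    using assms(1-3) by (rule even_mooreI)
  interpret pair_graph G
    using assms(3) by (simp add: minimal_cage_def cage_def regular_girth_graph_def connected_graph_def)
  let ?D = "{graph_dist G u v | u v. u \<in> pverts G \<and> v \<in> pverts G}"
  have "?D = (\<Union>u\<in>pverts G. graph_dist G u ` pverts G)" by auto
  also have "\<dots> = (\<Union>u\<in>pverts G. rdist (parcs G) u ` pverts G)"
    by (intro SUP_cong image_cong refl graph_dist_eq_rdist)
  finally have D: "?D = (\<Union>u\<in>pverts G. rdist (parcs G) u ` pverts G)" .
  \<comment> \<open>The diameter is not part of \<open>minimal_cage\<close>; it is computed here, so
    that the given \<open>d\<close> becomes the parameter of the locale.\<close>
  have "Max ?D = g div 2"
  proof (rule Max_eqI)
    show "finite ?D" unfolding D using finite_V by simp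
    show "n \<le> g div 2" if "n \<in> ?D" for n
    proof -
      have "n \<in> (\<Union>u\<in>pverts G. rdist (parcs G) u ` pverts G)"
        using that unfolding D .
      then obtain u v where "u \<in> pverts G" "v \<in> pverts G" "n = rdist (parcs G) u v"
        by blast
      then show ?thesis using dist_le by blast
    qed
    obtain u v where uv: "u \<in> pverts G" "v \<in> pverts G" "rdist (parcs G) u v = g div 2"
      using ex_dist_d by blast
    have "rdist (parcs G) u v \<in> ?D"
      unfolding D by (rule UN_I[OF uv(1) imageI[OF uv(2)]])
    then show "g div 2 \<in> ?D" using uv(3) by simp
  qed
  with assms(4) have "d = g div 2" unfolding graph_diameter_def by (rule trans[OF sym])
  show ?thesis
    unfolding \<open>d = g div 2\<close>
    by (rule distance_spectral_radius_subdivision[OF refl refl assms(5,6)])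
qed

end
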